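(* Let $C$ be an algebraically closed field of characteristic $0$, let $k$ be a finite extension of the differential field $(C(z),\frac{d}{dz})$, and let $K/k$ be a finite Galois extension with $m=[K:k]$. Let $s\ge 1$ and let $c$ be a 2-cocycle for $\mathrm{Gal}(K/k)$ with values in $C^*$ such that the class of $c^s$ in $H^2(\mathrm{Gal}(K/k),C^* )$ is trivial. Suppose that $c$ is given by elements $\{f_\sigma\mid \sigma\in \mathrm{Gal}(K/k)\}\subset K^*$ satisfying $$f_{\sigma\tau}=c(\sigma,\tau)\cdot f_\sigma\cdot \sigma(f_\tau)\quad\text{for all }\sigma,\tau\in \mathrm{Gal}(K/k).$$ Then: (1) With $G=\prod_{\tau\in \mathrm{Gal}(K/k)}f_\tau$, the field $K(\sqrt[m]{G})$ is a descent field for $(K,c)$. (2) There are elements $\{d(\sigma)\mid\sigma\in \mathrm{Gal}(K/k)\}\subset C^*$ with $d(\sigma\tau)=c(\sigma,\tau)^s d(\sigma)d(\tau)$ for all $\sigma,\tau$. For any such $d$ there is an $F\in K^*$ with $\frac{f_\sigma^s}{d(\sigma)}=\frac{\sigma(F)}{F}$ for all $\sigma\in \mathrm{Gal}(K/k)$, and for any such $F$ the field $K(\sqrt[s]{F})$ is a descent field for $(K,c)$.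
   Context: $\mathrm{Gal}(K/k)$ acts trivially on $C^*$. Let $K/k$ be a Galois extension and $c$ a 2-cocycle for $\mathrm{Gal}(K/k)$ with values in $C^*$ such that $c^s$ is trivial in cohomology. A descent field for $(K,c)$ is a Galois extension $K'\supset k$ containing $K$ such that the induced 2-cocycle $c'$ for $\mathrm{Gal}(K'/k)$, defined by $c'(g_1,g_2)=c(\mathrm{pr}\,g_1,\mathrm{pr}\,g_2)$, has trivial class in $H^2(\mathrm{Gal}(K'/k),C^* )$; here $\mathrm{pr}:\mathrm{Gal}(K'/k)\to \mathrm{Gal}(K/k)$ is the natural map. *)

theory Defs
  imports "HOL-Algebra.Algebra" "HOL-Algebra.Finite_Extensions"
begin

text \<open>
  All fields are subfields of one ambient field \<open>\<Omega>\<close>. Nothing else is assumed of \<open>\<Omega>\<close>, so a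
  statement about all \<open>w \<in> carrier \<Omega>\<close> with \<open>w\<^sup>n = a\<close> covers every realisation of
  \<open>K(\<^sup>n\<surd>a)\<close>: take \<open>\<Omega>\<close> to be an algebraic closure of \<open>K\<close>, or \<open>K(\<^sup>n\<surd>a)\<close> itself.
\<close>

abbreviation sub_ring_of :: "('a, 'b) ring_scheme \<Rightarrow> 'a set \<Rightarrow> ('a, 'b) ring_scheme" where
  "sub_ring_of \<Omega> K \<equiv> \<Omega>\<lparr>carrier := K\<rparr>"

definition char_zero :: "('a, 'b) ring_scheme \<Rightarrow> bool" where
  "char_zero R \<longleftrightarrow> (\<forall>n::nat. 0 < n \<longrightarrow> [n] \<cdot>\<^bsub>R\<^esub> \<one>\<^bsub>R\<^esub> \<noteq> \<zero>\<^bsub>R\<^esub>)"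

definition derivation_on :: "('a, 'b) ring_scheme \<Rightarrow> 'a set \<Rightarrow> ('a \<Rightarrow> 'a) \<Rightarrow> bool" where
  "derivation_on \<Omega> k D \<longleftrightarrow>
     D \<in> k \<rightarrow> k \<and>
     (\<forall>x\<in>k. \<forall>y\<in>k. D (x \<oplus>\<^bsub>\<Omega>\<^esub> y) = D x \<oplus>\<^bsub>\<Omega>\<^esub> D y) \<and>
     (\<forall>x\<in>k. \<forall>y\<in>k. D (x \<otimes>\<^bsub>\<Omega>\<^esub> y) = D x \<otimes>\<^bsub>\<Omega>\<^esub> y \<oplus>\<^bsub>\<Omega>\<^esub> x \<otimes>\<^bsub>\<Omega>\<^esub> D y)"

text \<open>
  \<open>(k, D)\<close> is a finite extension of the differential field \<open>(C(z), d/dz)\<close>: \<open>d/dz\<close> is the only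
  derivation of \<open>C(z)\<close> that vanishes on \<open>C\<close> and maps \<open>z\<close> to \<open>1\<close>.
\<close>

definition finite_ext_of_rational_functions ::
  "('a, 'b) ring_scheme \<Rightarrow> 'a set \<Rightarrow> 'a \<Rightarrow> 'a set \<Rightarrow> ('a \<Rightarrow> 'a) \<Rightarrow> bool" where
  "finite_ext_of_rational_functions \<Omega> C z k D \<longleftrightarrow>
     subfield C \<Omega> \<and> subfield k \<Omega> \<and>
     z \<in> carrier \<Omega> \<and> ring.transcendental \<Omega> C z \<and>
     generate_field \<Omega> (insert z C) \<subseteq> k \<and>
     ring.finite_dimension \<Omega> (generate_field \<Omega> (insert z C)) k \<and>
     derivation_on \<Omega> k D \<and> (\<forall>a\<in>C. D a = \<zero>\<^bsub>\<Omega>\<^esub>) \<and> D z = \<one>\<^bsub>\<Omega>\<^esub>"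


text \<open>Automorphisms are extensional on \<open>K\<close>, so that each one is a single element.\<close>

definition Gal :: "('a, 'b) ring_scheme \<Rightarrow> 'a set \<Rightarrow> 'a set \<Rightarrow> ('a \<Rightarrow> 'a) set" where
  "Gal \<Omega> K k =
     {\<sigma> \<in> Bij K. \<sigma> \<in> ring_hom (sub_ring_of \<Omega> K) (sub_ring_of \<Omega> K) \<and> (\<forall>x\<in>k. \<sigma> x = x)}"

definition GalGroup :: "('a, 'b) ring_scheme \<Rightarrow> 'a set \<Rightarrow> 'a set \<Rightarrow> ('a \<Rightarrow> 'a) monoid" where
  "GalGroup \<Omega> K k = (BijGroup K)\<lparr>carrier := Gal \<Omega> K k\<rparr>"

text \<open>
  Only finite Galois extensions occur; for these \<open>H\<^sup>2\<close> of the abstract group \<open>Gal(K/k)\<close> needs no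
  continuity condition on cochains.
\<close>

definition finite_galois :: "('a, 'b) ring_scheme \<Rightarrow> 'a set \<Rightarrow> 'a set \<Rightarrow> bool" where
  "finite_galois \<Omega> K k \<longleftrightarrow>
     subfield k \<Omega> \<and> subfield K \<Omega> \<and> k \<subseteq> K \<and> ring.finite_dimension \<Omega> k K \<and>
     {x \<in> K. \<forall>\<sigma> \<in> Gal \<Omega> K k. \<sigma> x = x} = k"


text \<open>
  \<open>H\<^sup>2(\<Gamma>, A)\<close> for an abelian group \<open>A\<close> with trivial \<open>\<Gamma>\<close>-action, as 2-cocycles modulo
  2-coboundaries. Cochains are extensional functions on \<open>\<Gamma> \<times> \<Gamma>\<close>, multiplied pointwise.
\<close>

definition cocycles2 :: "('g, 'h) monoid_scheme \<Rightarrow> ('a, 'b) monoid_scheme \<Rightarrow> ('g \<times> 'g \<Rightarrow> 'a) monoid" where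
  "cocycles2 \<Gamma> A =
     (let Cochains = product_group (carrier \<Gamma> \<times> carrier \<Gamma>) (\<lambda>_. A) in
      Cochains\<lparr>carrier := {c \<in> carrier Cochains.
        \<forall>\<sigma> \<in> carrier \<Gamma>. \<forall>\<tau> \<in> carrier \<Gamma>. \<forall>\<rho> \<in> carrier \<Gamma>.
          c (\<sigma>, \<tau>) \<otimes>\<^bsub>A\<^esub> c (\<sigma> \<otimes>\<^bsub>\<Gamma>\<^esub> \<tau>, \<rho>) = c (\<tau>, \<rho>) \<otimes>\<^bsub>A\<^esub> c (\<sigma>, \<tau> \<otimes>\<^bsub>\<Gamma>\<^esub> \<rho>)}\<rparr>)"

definition coboundaries2 :: "('g, 'h) monoid_scheme \<Rightarrow> ('a, 'b) monoid_scheme \<Rightarrow> ('g \<times> 'g \<Rightarrow> 'a) set" where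
  "coboundaries2 \<Gamma> A =
     {\<lambda>(\<sigma>, \<tau>) \<in> carrier \<Gamma> \<times> carrier \<Gamma>. b \<sigma> \<otimes>\<^bsub>A\<^esub> b \<tau> \<otimes>\<^bsub>A\<^esub> inv\<^bsub>A\<^esub> b (\<sigma> \<otimes>\<^bsub>\<Gamma>\<^esub> \<tau>) | b.
        b \<in> carrier \<Gamma> \<rightarrow> carrier A}"

definition H2 :: "('g, 'h) monoid_scheme \<Rightarrow> ('a, 'b) monoid_scheme \<Rightarrow> ('g \<times> 'g \<Rightarrow> 'a) set monoid" where
  "H2 \<Gamma> A = cocycles2 \<Gamma> A Mod coboundaries2 \<Gamma> A"

definition H2_class ::
  "('g, 'h) monoid_scheme \<Rightarrow> ('a, 'b) monoid_scheme \<Rightarrow> ('g \<times> 'g \<Rightarrow> 'a) \<Rightarrow> ('g \<times> 'g \<Rightarrow> 'a) set" where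
  "H2_class \<Gamma> A c = coboundaries2 \<Gamma> A #>\<^bsub>cocycles2 \<Gamma> A\<^esub> c"


text \<open>\<open>HOL-Algebra\<close> defines \<open>mult_of\<close> twice, identically; hence the qualified name.\<close>

abbreviation units_group :: "('a, 'b) ring_scheme \<Rightarrow> 'a set \<Rightarrow> 'a monoid" where
  "units_group \<Omega> C \<equiv> Ring_Divisibility.mult_of (sub_ring_of \<Omega> C)"

text \<open>The pullback of \<open>c\<close> along the restriction map \<open>pr : Gal(K'/k) \<rightarrow> Gal(K/k)\<close>.\<close>

definition induced_cocycle ::
  "('a, 'b) ring_scheme \<Rightarrow> 'a set \<Rightarrow> 'a set \<Rightarrow> 'a set \<Rightarrow>
   (('a \<Rightarrow> 'a) \<times> ('a \<Rightarrow> 'a) \<Rightarrow> 'a) \<Rightarrow> ('a \<Rightarrow> 'a) \<times> ('a \<Rightarrow> 'a) \<Rightarrow> 'a" where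
  "induced_cocycle \<Omega> K' K k c =
     (\<lambda>(g1, g2) \<in> Gal \<Omega> K' k \<times> Gal \<Omega> K' k. c (restrict g1 K, restrict g2 K))"

definition descent_field ::
  "('a, 'b) ring_scheme \<Rightarrow> 'a set \<Rightarrow> 'a set \<Rightarrow> 'a set \<Rightarrow>
   (('a \<Rightarrow> 'a) \<times> ('a \<Rightarrow> 'a) \<Rightarrow> 'a) \<Rightarrow> 'a set \<Rightarrow> bool" where
  "descent_field \<Omega> C k K c K' \<longleftrightarrow>
     finite_galois \<Omega> K' k \<and> K \<subseteq> K' \<and>
     H2_class (GalGroup \<Omega> K' k) (units_group \<Omega> C) (induced_cocycle \<Omega> K' K k c)
       = \<one>\<^bsub>H2 (GalGroup \<Omega> K' k) (units_group \<Omega> C)\<^esub>"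

end

theory Submission
  imports Defs
begin

text \<open>
  Everything reduces to one statement about radical extensions: if \<open>F \<in> K\<^sup>*\<close>, an exponent \<open>n \<ge> 1\<close>
  and constants \<open>d(\<sigma>) \<in> C\<^sup>*\<close> satisfy \<open>f\<^sub>\<sigma>\<^sup>n / d(\<sigma>) = \<sigma>(F) / F\<close> for all \<open>\<sigma>\<close>, and \<open>w\<^sup>n = F\<close>, then
  \<open>K(w)\<close> is a descent field (\<open>descent_field_of_root\<close>). Indeed, for \<open>g \<in> Gal(K(w)/k)\<close> over \<open>\<sigma>\<close> the
  quotient \<open>b(g) = g(w) / (w f\<^sub>\<sigma>)\<close> has \<open>n\<close>-th power \<open>1 / d(\<sigma>)\<close>, so it lies in the algebraically
  closed field \<open>C\<close>, on which the Galois group acts trivially; applying \<open>gh\<close> to \<open>w\<close> in two ways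
  shows that the pullback of \<open>c\<close> is the coboundary of \<open>b\<close>.

  In part (2), \<open>d\<close> comes from a cochain with coboundary \<open>c\<^sup>s\<close>, the elements \<open>f\<^sub>\<sigma>\<^sup>s / d(\<sigma>)\<close> form a
  1-cocycle with values in \<open>K\<^sup>*\<close>, and Hilbert 90 (\<open>hilbert90\<close>) provides \<open>F\<close>. In part (1), the
  product of \<open>f\<^sub>\<sigma>\<^sub>\<tau> = c(\<sigma>,\<tau>) f\<^sub>\<sigma> \<sigma>(f\<^sub>\<tau>)\<close> over \<open>\<tau>\<close> reads \<open>G = (\<Prod>\<^sub>\<tau> c(\<sigma>,\<tau>)) f\<^sub>\<sigma>\<^sup>m \<sigma>(G)\<close>
  (\<open>norm_of_cochain\<close>), because \<open>m = |Gal(K/k)|\<close> (\<open>card_gal\<close>); so the exponent \<open>m\<close>, \<open>F = 1/G\<close> and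
  \<open>d(\<sigma>) = 1 / \<Prod>\<^sub>\<tau> c(\<sigma>,\<tau>)\<close> satisfy the hypothesis, and \<open>K(w) = K(1/w)\<close>.

  The remaining point is that \<open>K(w)/k\<close> is Galois (\<open>galois_K'\<close>). Each \<open>\<sigma>(F)/F\<close> is an \<open>n\<close>-th power
  \<open>u\<^sup>n\<close> in \<open>K\<close>, and the pairs \<open>(\<sigma>, u)\<close> form a finite group acting on \<open>K[X]\<close> by
  \<open>\<Sum> a\<^sub>i X\<^sup>i \<mapsto> \<Sum> \<sigma>(a\<^sub>i) (u X)\<^sup>i\<close>. The polynomial \<open>X\<^sup>n - F\<close> may be reducible, so a pair need not
  act on \<open>K(w)\<close>. Instead of factoring, the argument uses that the invariant polynomials take values
  in \<open>k\<close> at \<open>w\<close> (\<open>ev_trace_in_base\<close>), and that the pairs preserving the kernel of evaluation at \<open>w\<close>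
  account for all of \<open>Gal(K(w)/k)\<close> that is needed: an element of \<open>K(w)\<close> fixed by
  them lifts to a polynomial that vanishes under all other pairs, and its trace is a nonzero integer
  multiple of the given element (\<open>fixed_in_base\<close>).

  The Galois theory of \<open>K/k\<close> itself (order of the group, normality, Hilbert 90) rests
  on Dedekind's independence of characters and on underdetermined linear systems.
\<close>

section \<open>Linear systems, characters and bases\<close>

lemma (in ring) finsum_in_subring:
  assumes "subring K R" and "h \<in> A \<rightarrow> K"
  shows "(\<Oplus>a\<in>A. h a) \<in> K"
  using assms(2)
proof (induction A rule: infinite_finite_induct)
  case (insert x A)
  have "K \<subseteq> carrier R" by (rule subringE(1)[OF assms(1)])
  hence "(\<Oplus>a\<in>insert x A. h a) = h x \<oplus> (\<Oplus>a\<in>A. h a)"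
    using insert by (intro finsum_insert) auto
  then show ?case using insert subringE(7)[OF assms(1)] by auto
qed (auto simp: subringE(2)[OF assms(1)])

lemma (in ring) finsum_minus:
  assumes "f \<in> A \<rightarrow> carrier R" and "g \<in> A \<rightarrow> carrier R"
  shows "(\<Oplus>a\<in>A. f a \<ominus> g a) = (\<Oplus>a\<in>A. f a) \<ominus> (\<Oplus>a\<in>A. g a)"
  using assms
proof (induction A rule: infinite_finite_induct)
  case (insert x A)
  have eq: "(a \<ominus> b) \<oplus> (c \<ominus> d) = (a \<oplus> c) \<ominus> (b \<oplus> d)"
    if "a \<in> carrier R" "b \<in> carrier R" "c \<in> carrier R" "d \<in> carrier R" for a b c d
    using that by algebra
  from insert have "f \<in> A \<rightarrow> carrier R" "g \<in> A \<rightarrow> carrier R" "f x \<in> carrier R" "g x \<in> carrier R"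
    by auto
  then show ?case using insert by (simp add: Pi_def eq)
qed (auto simp: minus_eq)

lemma (in ring) finsum_swap:
  assumes "finite A" "finite B" "\<And>a b. a \<in> A \<Longrightarrow> b \<in> B \<Longrightarrow> f a b \<in> carrier R"
  shows "(\<Oplus>a\<in>A. \<Oplus>b\<in>B. f a b) = (\<Oplus>b\<in>B. \<Oplus>a\<in>A. f a b)"
  using assms(1,3)
proof (induction A)
  case (insert x A)
  have "(\<Oplus>b\<in>B. \<Oplus>a\<in>insert x A. f a b) = (\<Oplus>b\<in>B. f x b \<oplus> (\<Oplus>a\<in>A. f a b))"
    using insert by (intro finsum_cong' finsum_insert) (auto intro!: finsum_closed)
  also have "\<dots> = (\<Oplus>b\<in>B. f x b) \<oplus> (\<Oplus>b\<in>B. \<Oplus>a\<in>A. f a b)"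
    using insert by (intro finsum_addf) (auto intro!: finsum_closed)
  also have "\<dots> = (\<Oplus>b\<in>B. f x b) \<oplus> (\<Oplus>a\<in>A. \<Oplus>b\<in>B. f a b)"
    using insert by auto
  also have "\<dots> = (\<Oplus>a\<in>insert x A. \<Oplus>b\<in>B. f a b)"
    using insert by (intro finsum_insert[symmetric]) (auto intro!: finsum_closed)
  finally show ?case by simp
qed (simp add: assms(2))

lemma (in ring) hom_finsum_subring:
  assumes "subring K R" and "\<phi> \<in> ring_hom (R\<lparr>carrier := K\<rparr>) R" and "h \<in> A \<rightarrow> K"
  shows "\<phi> (\<Oplus>a\<in>A. h a) = (\<Oplus>a\<in>A. \<phi> (h a))"
proof -
  have zero: "\<phi> \<zero> = \<zero>"
    using ring_hom_zero[OF assms(2) subring_is_ring[OF assms(1)] ring_axioms] by simp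
  show ?thesis using assms(3)
  proof (induction A rule: infinite_finite_induct)
    case (insert x A)
    have K: "K \<subseteq> carrier R" by (rule subringE(1)[OF assms(1)])
    have sK: "\<phi> y \<in> carrier R" if "y \<in> K" for y
      using ring_hom_closed[OF assms(2)] that by auto
    have "(\<Oplus>a\<in>insert x A. h a) = h x \<oplus> (\<Oplus>a\<in>A. h a)"
      using insert K by (intro finsum_insert) auto
    moreover have "\<phi> (h x \<oplus> (\<Oplus>a\<in>A. h a)) = \<phi> (h x) \<oplus> \<phi> (\<Oplus>a\<in>A. h a)"
      using ring_hom_add[OF assms(2), of "h x"] insert.prems finsum_in_subring[OF assms(1), of h A]
      by auto
    moreover have "(\<Oplus>a\<in>insert x A. \<phi> (h a)) = \<phi> (h x) \<oplus> (\<Oplus>a\<in>A. \<phi> (h a))"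
      using insert sK by (intro finsum_insert) auto
    ultimately show ?case using insert by auto
  qed (auto simp: zero)
qed

text \<open>
  Gaussian elimination, one equation at a time. The coefficients and the solution stay in
  the subfield \<open>K\<close>; the solution is needed both over \<open>\<Omega>\<close> (for counting embeddings) and over a
  proper subfield (for Artin's bound).
\<close>

lemma (in field) underdetermined_system:
  assumes K: "subfield K R"
    and "finite I" "finite J" "card I < card J"
    and "\<And>i j. i \<in> I \<Longrightarrow> j \<in> J \<Longrightarrow> A i j \<in> K"
  shows "\<exists>x. x \<in> J \<rightarrow> K \<and> (\<exists>j\<in>J. x j \<noteq> \<zero>) \<and> (\<forall>i\<in>I. (\<Oplus>j\<in>J. A i j \<otimes> x j) = \<zero>)"
  using assms(2-)
proof (induction I arbitrary: J A)
  case empty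
  then obtain j where "j \<in> J" by fastforce
  then show ?case
    by (intro exI[of _ "\<lambda>_. \<one>"]) (use subringE(3)[OF subfieldE(1)[OF K]] in auto)
next
  case (insert i I)
  note KR = subringE[OF subfieldE(1)[OF K]]
  have Kc: "y \<in> carrier R" if "y \<in> K" for y using KR(1) that by auto
  show ?case
  proof (cases "\<forall>j\<in>J. A i j = \<zero>")
    case True
    obtain x where x: "x \<in> J \<rightarrow> K" "\<exists>j\<in>J. x j \<noteq> \<zero>" "\<forall>i\<in>I. (\<Oplus>j\<in>J. A i j \<otimes> x j) = \<zero>"
      using insert.IH[of J A] insert.prems insert.hyps by auto
    have "(\<Oplus>j\<in>J. A i j \<otimes> x j) = \<zero>"
      using True x(1) Kc by (intro add.finprod_one_eqI) (simp add: Pi_iff)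
    with x show ?thesis by auto
  next
    case False
    then obtain p where p: "p \<in> J" "A i p \<noteq> \<zero>" by auto
    define q where "q = inv (A i p)"
    have AK: "A i' j \<in> K" if "i' \<in> insert i I" "j \<in> J" for i' j using insert.prems that by auto
    have ip: "A i p \<in> K" "A i p \<in> carrier R" using AK p Kc by auto
    have q: "q \<in> K" "A i p \<otimes> q = \<one>" "q \<in> carrier R"
      using subfield_m_inv[OF K, of "A i p"] ip p Kc unfolding q_def by auto
    define J' where "J' = J - {p}"
    have J: "J = insert p J'" "p \<notin> J'" "finite J'" using p insert.prems(1) J'_def by auto
    \<comment> \<open>Row reduction with pivot \<open>p\<close>.\<close>
    define B where "B i' j = A i' j \<ominus> A i' p \<otimes> q \<otimes> A i j" for i' j
    have BK: "B i' j \<in> K" if "i' \<in> I" "j \<in> J'" for i' j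
      unfolding B_def minus_eq using AK q KR that J by (auto intro!: KR)
    obtain x where x: "x \<in> J' \<rightarrow> K" "\<exists>j\<in>J'. x j \<noteq> \<zero>" "\<forall>i'\<in>I. (\<Oplus>j\<in>J'. B i' j \<otimes> x j) = \<zero>"
      using insert.IH[of J' B] insert.prems insert.hyps BK J by auto
    define S where "S = (\<Oplus>j\<in>J'. A i j \<otimes> x j)"
    define y where "y j = (if j = p then \<ominus> (q \<otimes> S) else x j)" for j
    have SK: "S \<in> K" unfolding S_def
      using x(1) AK J by (intro finsum_in_subring[OF subfieldE(1)[OF K]]) (auto intro!: KR(6))
    have "\<ominus> (q \<otimes> S) \<in> K" using q(1) SK by (intro KR(5,6))
    hence yK: "y \<in> J \<rightarrow> K" using x(1) J by (auto simp: y_def)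
    have yc: "y j \<in> carrier R" if "j \<in> J" for j using yK Kc that by auto
    have xc: "x j \<in> carrier R" if "j \<in> J'" for j using x(1) Kc that by auto
    have split: "(\<Oplus>j\<in>J. A i' j \<otimes> y j) = A i' p \<otimes> \<ominus> (q \<otimes> S) \<oplus> (\<Oplus>j\<in>J'. A i' j \<otimes> x j)"
      if "i' \<in> insert i I" for i'
    proof -
      have "(\<Oplus>j\<in>J. A i' j \<otimes> y j) = A i' p \<otimes> y p \<oplus> (\<Oplus>j\<in>J'. A i' j \<otimes> y j)"
        unfolding J(1) using yc AK that J Kc by (intro finsum_insert) auto
      also have "(\<Oplus>j\<in>J'. A i' j \<otimes> y j) = (\<Oplus>j\<in>J'. A i' j \<otimes> x j)"
        using xc AK that J Kc by (intro finsum_cong') (auto simp: y_def)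
      finally show ?thesis by (simp add: y_def)
    qed
    have "(\<Oplus>j\<in>J. A i' j \<otimes> y j) = \<zero>" if i': "i' \<in> insert i I" for i'
    proof (cases "i' = i")
      case True
      have "A i p \<otimes> \<ominus> (q \<otimes> S) \<oplus> S = \<ominus> ((A i p \<otimes> q) \<otimes> S) \<oplus> S"
        using ip(2) q(3) Kc[OF SK] by (simp add: r_minus m_assoc)
      also have "\<dots> = \<zero>" using q SK Kc by (simp add: l_neg)
      finally show ?thesis using split[OF i'] True unfolding S_def by simp
    next
      case False
      hence iI: "i' \<in> I" using i' by auto
      have Ai: "A i' p \<in> carrier R" using AK[OF i'] p Kc by auto
      have c: "A i' j \<in> carrier R" "A i j \<in> carrier R" "x j \<in> carrier R" if "j \<in> J'" for j
        using AK i' that J Kc x(1) by auto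
      have "\<zero> = (\<Oplus>j\<in>J'. B i' j \<otimes> x j)" using x(3) iI by auto
      also have "\<dots> = (\<Oplus>j\<in>J'. A i' j \<otimes> x j \<ominus> (A i' p \<otimes> q) \<otimes> (A i j \<otimes> x j))"
      proof (intro finsum_cong')
        fix j assume "j \<in> J'"
        then show "B i' j \<otimes> x j = A i' j \<otimes> x j \<ominus> (A i' p \<otimes> q) \<otimes> (A i j \<otimes> x j)"
          unfolding B_def using c[of j] Ai q(3) by algebra
      qed (use c Ai q(3) in auto)
      also have "\<dots> = (\<Oplus>j\<in>J'. A i' j \<otimes> x j) \<ominus> (\<Oplus>j\<in>J'. (A i' p \<otimes> q) \<otimes> (A i j \<otimes> x j))"
        using c Ai q(3) by (intro finsum_minus) auto
      also have "(\<Oplus>j\<in>J'. (A i' p \<otimes> q) \<otimes> (A i j \<otimes> x j)) = (A i' p \<otimes> q) \<otimes> S"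
        unfolding S_def using c Ai q(3) J(3) by (intro finsum_rdistr[symmetric]) auto
      finally have z: "(\<Oplus>j\<in>J'. A i' j \<otimes> x j) \<ominus> (A i' p \<otimes> q) \<otimes> S = \<zero>" by simp
      have T: "(\<Oplus>j\<in>J'. A i' j \<otimes> x j) \<in> carrier R" using c by (intro finsum_closed) auto
      have "A i' p \<otimes> \<ominus> (q \<otimes> S) \<oplus> (\<Oplus>j\<in>J'. A i' j \<otimes> x j)
          = (\<Oplus>j\<in>J'. A i' j \<otimes> x j) \<ominus> (A i' p \<otimes> q) \<otimes> S"
      proof -
        have "a \<otimes> \<ominus> (b \<otimes> s) \<oplus> t = t \<ominus> a \<otimes> b \<otimes> s"
          if "a \<in> carrier R" "b \<in> carrier R" "s \<in> carrier R" "t \<in> carrier R" for a b s t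
          using that by algebra
        then show ?thesis using T Ai q(3) Kc[OF SK] by simp
      qed
      then show ?thesis unfolding split[OF i'] z .
    qed
    moreover have "\<exists>j\<in>J. y j \<noteq> \<zero>" using x(2) J by (auto simp: y_def)
    ultimately show ?thesis using yK by blast
  qed
qed

text \<open>
  Dedekind's lemma. If \<open>\<phi> y \<noteq> \<psi> y\<close>, then the relation at \<open>x \<otimes> y\<close> minus \<open>\<psi> y\<close> times the relation
  at \<open>x\<close> no longer contains \<open>\<psi>\<close> and still has a coefficient at \<open>\<phi>\<close> that vanishes only if the
  original one does.
\<close>

lemma (in domain) dedekind_independence:
  assumes "monoid M" "finite S"
    and "\<And>\<chi>. \<chi> \<in> S \<Longrightarrow> \<chi> \<in> hom M R \<and> \<chi> \<one>\<^bsub>M\<^esub> = \<one>"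
    and "inj_on (\<lambda>\<chi>. restrict \<chi> (carrier M)) S"
    and "a \<in> S \<rightarrow> carrier R"
    and "\<And>x. x \<in> carrier M \<Longrightarrow> (\<Oplus>\<chi>\<in>S. a \<chi> \<otimes> \<chi> x) = \<zero>"
  shows "\<forall>\<chi>\<in>S. a \<chi> = \<zero>"
  using assms(2-)
proof (induction S arbitrary: a)
  case (insert \<psi> S)
  interpret M: monoid M by fact
  have cl: "\<chi> x \<in> carrier R" if "\<chi> \<in> insert \<psi> S" "x \<in> carrier M" for \<chi> x
    using insert.prems(1)[OF that(1)] that(2) by (auto simp: hom_def)
  have mu: "\<chi> (x \<otimes>\<^bsub>M\<^esub> y) = \<chi> x \<otimes> \<chi> y" if "\<chi> \<in> insert \<psi> S" "x \<in> carrier M" "y \<in> carrier M" for \<chi> x y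
    using insert.prems(1)[OF that(1)] that(2-) by (auto simp: hom_def)
  have ac: "a \<chi> \<in> carrier R" if "\<chi> \<in> insert \<psi> S" for \<chi> using insert.prems(3) that by auto
  have rel: "a \<psi> \<otimes> \<psi> x \<oplus> (\<Oplus>\<chi>\<in>S. a \<chi> \<otimes> \<chi> x) = \<zero>" if "x \<in> carrier M" for x
    using insert.prems(4)[OF that] insert.hyps ac cl that
    by (subst (asm) finsum_insert) auto
  have S0: "a \<phi> = \<zero>" if phi: "\<phi> \<in> S" for \<phi>
  proof -
    have "restrict \<phi> (carrier M) \<noteq> restrict \<psi> (carrier M)"
      using inj_onD[OF insert.prems(2), of \<phi> \<psi>] insert.hyps(2) phi by (auto simp del: restrict_apply)
    then obtain y where y: "y \<in> carrier M" "\<phi> y \<noteq> \<psi> y" by (meson restrict_ext)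
    define b where "b \<chi> = a \<chi> \<otimes> (\<chi> y \<ominus> \<psi> y)" for \<chi>
    have "(\<Oplus>\<chi>\<in>S. b \<chi> \<otimes> \<chi> x) = \<zero>" if x: "x \<in> carrier M" for x
    proof -
      have c: "\<chi> x \<in> carrier R" "\<chi> y \<in> carrier R" "a \<chi> \<in> carrier R" "\<psi> y \<in> carrier R"
        if "\<chi> \<in> insert \<psi> S" for \<chi>
        using cl ac that x y(1) by auto
      have cxy: "\<chi> (x \<otimes>\<^bsub>M\<^esub> y) \<in> carrier R" if "\<chi> \<in> insert \<psi> S" for \<chi>
        using cl[OF that] x y(1) by auto
      have sc: "(\<Oplus>\<chi>\<in>S. a \<chi> \<otimes> \<chi> z) \<in> carrier R" if "z \<in> carrier M" for z
        using cl ac that by (intro finsum_closed) auto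
      have "(\<Oplus>\<chi>\<in>S. b \<chi> \<otimes> \<chi> x)
          = (\<Oplus>\<chi>\<in>S. a \<chi> \<otimes> \<chi> (x \<otimes>\<^bsub>M\<^esub> y) \<ominus> \<psi> y \<otimes> (a \<chi> \<otimes> \<chi> x))"
      proof (intro finsum_cong')
        fix \<chi> assume "\<chi> \<in> S"
        then show "b \<chi> \<otimes> \<chi> x = a \<chi> \<otimes> \<chi> (x \<otimes>\<^bsub>M\<^esub> y) \<ominus> \<psi> y \<otimes> (a \<chi> \<otimes> \<chi> x)"
          unfolding b_def using c[of \<chi>] mu[of \<chi> x y] x y(1) by (simp, algebra)
      qed (use c cxy x y in \<open>auto intro!: minus_closed\<close>)
      also have "\<dots> = (\<Oplus>\<chi>\<in>S. a \<chi> \<otimes> \<chi> (x \<otimes>\<^bsub>M\<^esub> y)) \<ominus> (\<Oplus>\<chi>\<in>S. \<psi> y \<otimes> (a \<chi> \<otimes> \<chi> x))"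
        using c cl x y by (intro finsum_minus) auto
      also have "(\<Oplus>\<chi>\<in>S. \<psi> y \<otimes> (a \<chi> \<otimes> \<chi> x)) = \<psi> y \<otimes> (\<Oplus>\<chi>\<in>S. a \<chi> \<otimes> \<chi> x)"
        using c insert.hyps by (intro finsum_rdistr[symmetric]) auto
      also have "(\<Oplus>\<chi>\<in>S. a \<chi> \<otimes> \<chi> (x \<otimes>\<^bsub>M\<^esub> y)) = \<ominus> (a \<psi> \<otimes> (\<psi> x \<otimes> \<psi> y))"
        using rel[of "x \<otimes>\<^bsub>M\<^esub> y"] mu[of \<psi> x y] sc[of "x \<otimes>\<^bsub>M\<^esub> y"] x y c[of \<psi>]
        by (metis (no_types, lifting) M.m_closed a_comm add.inv_equality insertI1 m_closed sum_zero_eq_neg)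
      also have "(\<Oplus>\<chi>\<in>S. a \<chi> \<otimes> \<chi> x) = \<ominus> (a \<psi> \<otimes> \<psi> x)"
        using rel[of x] sc[of x] x c[of \<psi>]
        by (metis (no_types, lifting) a_comm insertI1 m_closed sum_zero_eq_neg)
      also have "\<ominus> (a \<psi> \<otimes> (\<psi> x \<otimes> \<psi> y)) \<ominus> \<psi> y \<otimes> \<ominus> (a \<psi> \<otimes> \<psi> x) = \<zero>"
        using c[of \<psi>] by (simp, algebra)
      finally show ?thesis .
    qed
    moreover have "b \<in> S \<rightarrow> carrier R" unfolding b_def using cl ac y by auto
    ultimately have "\<forall>\<chi>\<in>S. b \<chi> = \<zero>"
      using insert.IH[of b] insert.prems(1,2) by (auto simp: inj_on_def)
    hence "a \<phi> \<otimes> (\<phi> y \<ominus> \<psi> y) = \<zero>" using phi unfolding b_def by auto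
    moreover have "\<phi> y \<ominus> \<psi> y \<noteq> \<zero>" using y cl phi by auto
    ultimately show ?thesis using integral_iff cl ac phi y(1)
      by (metis insertCI minus_closed)
  qed
  have "(\<Oplus>\<chi>\<in>S. a \<chi> \<otimes> \<chi> \<one>\<^bsub>M\<^esub>) = \<zero>"
    using S0 cl by (intro add.finprod_one_eqI) auto
  hence "a \<psi> = \<zero>"
    using rel[of "\<one>\<^bsub>M\<^esub>"] insert.prems(1)[of \<psi>] ac[of \<psi>] by simp
  with S0 show ?case by auto
qed auto

lemma (in ring) finsum_in_space:
  assumes "subfield K R" "dimension n K E" and "f \<in> A \<rightarrow> E"
  shows "(\<Oplus>a\<in>A. f a) \<in> E"
  using assms(3)
proof (induction A rule: infinite_finite_induct)
  case (insert x A)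
  note E = space_subgroup_props[OF assms(1,2)]
  have "(\<Oplus>a\<in>insert x A. f a) = f x \<oplus> (\<Oplus>a\<in>A. f a)"
    using insert E(1) by (intro finsum_insert) auto
  then show ?case using insert E(3) by auto
qed (auto simp: space_subgroup_props(2)[OF assms(1,2)])

text \<open>
  Dimension is defined by adjoining one line at a time; interchanging sums calls for an indexed
  basis.
\<close>

lemma (in ring) dimension_imp_basis:
  assumes "dimension n K E" "subfield K R"
  shows "\<exists>e \<in> {..<n} \<rightarrow> E. (\<forall>y\<in>E. \<exists>a \<in> {..<n} \<rightarrow> K. y = (\<Oplus>i\<in>{..<n}. a i \<otimes> e i)) \<and>
    (\<forall>a \<in> {..<n} \<rightarrow> K. (\<Oplus>i\<in>{..<n}. a i \<otimes> e i) = \<zero> \<longrightarrow> (\<forall>i<n. a i = \<zero>))"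
  using assms
proof (induction rule: dimension.induct)
  case (Suc_dim v E n K)
  note E = space_subgroup_props[OF Suc_dim.prems Suc_dim.hyps(3)]
  have Kc: "x \<in> carrier R" if "x \<in> K" for x
    using subringE(1)[OF subfieldE(1)[OF Suc_dim.prems]] that by auto
  have K0: "\<zero> \<in> K" "\<one> \<in> K" using subringE(2,3)[OF subfieldE(1)[OF Suc_dim.prems]] by auto
  obtain e where e: "e \<in> {..<n} \<rightarrow> E"
    "\<And>y. y \<in> E \<Longrightarrow> \<exists>a \<in> {..<n} \<rightarrow> K. y = (\<Oplus>i\<in>{..<n}. a i \<otimes> e i)"
    "\<And>a. a \<in> {..<n} \<rightarrow> K \<Longrightarrow> (\<Oplus>i\<in>{..<n}. a i \<otimes> e i) = \<zero> \<Longrightarrow> \<forall>i<n. a i = \<zero>"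
    using Suc_dim.IH[OF Suc_dim.prems] by blast
  define e' where "e' = e(n := v)"
  have sum: "(\<Oplus>i\<in>{..<Suc n}. a i \<otimes> e' i) = a n \<otimes> v \<oplus> (\<Oplus>i\<in>{..<n}. a i \<otimes> e i)"
    if "a \<in> {..<Suc n} \<rightarrow> K" for a
  proof -
    have c: "a i \<otimes> e i \<in> carrier R" if "i \<in> {..<n}" for i
    proof -
      have "a i \<in> K" "e i \<in> E" using that \<open>a \<in> _\<close> e(1) by auto
      then show ?thesis using E(1) Kc by auto
    qed
    have "(\<Oplus>i\<in>{..<Suc n}. a i \<otimes> e' i) = a n \<otimes> e' n \<oplus> (\<Oplus>i\<in>{..<n}. a i \<otimes> e' i)"
      unfolding lessThan_Suc using c that Kc Suc_dim.hyps(1)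
      by (intro finsum_insert) (auto simp: e'_def)
    also have "(\<Oplus>i\<in>{..<n}. a i \<otimes> e' i) = (\<Oplus>i\<in>{..<n}. a i \<otimes> e i)"
      using c by (intro finsum_cong') (auto simp: e'_def)
    finally show ?thesis by (simp add: e'_def)
  qed
  have mem: "y \<in> line_extension K v E" if "y \<in> E" for y
  proof -
    have "y = \<zero> \<otimes> v \<oplus> y" using Suc_dim.hyps(1) that E(1) by auto
    then show ?thesis using K0 that unfolding line_extension_mem_iff by blast
  qed
  have "v = \<one> \<otimes> v \<oplus> \<zero>" using Suc_dim.hyps(1) by auto
  hence "v \<in> line_extension K v E" using K0 E(2) unfolding line_extension_mem_iff by blast
  hence 1: "e' \<in> {..<Suc n} \<rightarrow> line_extension K v E"
    using e(1) mem by (force simp: e'_def)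
  have 2: "\<exists>a \<in> {..<Suc n} \<rightarrow> K. y = (\<Oplus>i\<in>{..<Suc n}. a i \<otimes> e' i)"
    if "y \<in> line_extension K v E" for y
  proof -
    obtain k u where ku: "k \<in> K" "u \<in> E" "y = k \<otimes> v \<oplus> u"
      using \<open>y \<in> line_extension K v E\<close> unfolding line_extension_mem_iff by auto
    obtain a where a: "a \<in> {..<n} \<rightarrow> K" "u = (\<Oplus>i\<in>{..<n}. a i \<otimes> e i)" using e(2) ku by blast
    have aK: "a(n := k) \<in> {..<Suc n} \<rightarrow> K" using a(1) ku(1) by (auto simp: less_Suc_eq)
    have "(\<Oplus>i\<in>{..<n}. (a(n := k)) i \<otimes> e i) = u"
      unfolding a(2)
    proof (intro finsum_cong')
      have "a i \<in> carrier R" "e i \<in> carrier R" if "i < n" for i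
        using a(1) e(1) that E(1) Kc by blast+
      then show "(\<lambda>i. a i \<otimes> e i) \<in> {..<n} \<rightarrow> carrier R" by auto
    qed auto
    hence "y = (\<Oplus>i\<in>{..<Suc n}. (a(n := k)) i \<otimes> e' i)" using sum[OF aK] ku by simp
    with aK show ?thesis by blast
  qed
  have 3: "\<forall>i<Suc n. a i = \<zero>"
    if a: "a \<in> {..<Suc n} \<rightarrow> K" and z: "(\<Oplus>i\<in>{..<Suc n}. a i \<otimes> e' i) = \<zero>" for a
  proof -
    define u where "u = (\<Oplus>i\<in>{..<n}. a i \<otimes> e i)"
    have uE: "u \<in> E" unfolding u_def
    proof (intro finsum_in_space[OF Suc_dim.prems Suc_dim.hyps(3)] Pi_I)
      fix i assume "i \<in> {..<n}"
      hence "a i \<in> K" "e i \<in> E" using a e(1) by auto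
      then show "a i \<otimes> e i \<in> E" by (rule E(5))
    qed
    have uc: "u \<in> carrier R" using uE E(1) by auto
    have an: "a n \<in> K" "a n \<in> carrier R" using a Kc by auto
    have eq: "a n \<otimes> v \<oplus> u = \<zero>" using sum[OF a] z u_def by simp
    have "a n \<otimes> v = \<ominus> u"
      using eq uc an Suc_dim.hyps(1) by (simp add: add.inv_equality minus_equality)
    hence "a n \<otimes> v \<in> E" using E(4) uE by simp
    hence an0: "a n = \<zero>" using E(6)[of "a n" v] an Suc_dim.hyps(1,2) by auto
    hence "u = \<zero>" using eq uc Suc_dim.hyps(1) by simp
    moreover have "a \<in> {..<n} \<rightarrow> K" using a by auto
    ultimately have "\<forall>i<n. a i = \<zero>" using e(3)[of a] unfolding u_def by simp
    with an0 show ?thesis by (auto simp: less_Suc_eq)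
  qed
  show ?case using 1 2 3 by blast
qed auto

section \<open>The Galois group of a pair of subfields\<close>

locale subfield_pair = field \<Omega> for \<Omega> (structure) +
  fixes K k :: "'a set"
  assumes subfield_K: "subfield K \<Omega>" and subfield_k: "subfield k \<Omega>" and k_subset_K: "k \<subseteq> K"
begin

abbreviation "\<Gamma> \<equiv> Gal \<Omega> K k"

lemmas K_closed = subringE[OF subfieldE(1)[OF subfield_K]]
lemmas k_closed = subringE[OF subfieldE(1)[OF subfield_k]]

lemma K_carrier: "x \<in> K \<Longrightarrow> x \<in> carrier \<Omega>" using K_closed(1) by auto
lemma k_carrier: "x \<in> k \<Longrightarrow> x \<in> carrier \<Omega>" using k_closed(1) by auto

lemma K_inv: "x \<in> K \<Longrightarrow> x \<noteq> \<zero> \<Longrightarrow> inv x \<in> K \<and> inv x \<noteq> \<zero>"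
  using subfield_m_inv[OF subfield_K, of x] by auto

lemma K_pow: "x \<in> K \<Longrightarrow> x [^] (n::nat) \<in> K"
  by (induction n) (auto simp: K_closed)

lemma gal_bij: "\<phi> \<in> \<Gamma> \<Longrightarrow> bij_betw \<phi> K K"
  and gal_extensional: "\<phi> \<in> \<Gamma> \<Longrightarrow> \<phi> \<in> extensional K"
  and gal_fix: "\<phi> \<in> \<Gamma> \<Longrightarrow> x \<in> k \<Longrightarrow> \<phi> x = x"
  and gal_hom: "\<phi> \<in> \<Gamma> \<Longrightarrow> \<phi> \<in> ring_hom (sub_ring_of \<Omega> K) (sub_ring_of \<Omega> K)"
  by (auto simp: Gal_def Bij_def)

lemma gal_closed: "\<phi> \<in> \<Gamma> \<Longrightarrow> x \<in> K \<Longrightarrow> \<phi> x \<in> K"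
  using gal_hom[of \<phi>] by (auto simp: ring_hom_def)

lemma gal_emb: "\<phi> \<in> \<Gamma> \<Longrightarrow> \<phi> \<in> ring_hom (sub_ring_of \<Omega> K) \<Omega>"
  using gal_hom[of \<phi>] K_carrier by (auto simp: ring_hom_def)

lemma gal_mult: "\<phi> \<in> \<Gamma> \<Longrightarrow> x \<in> K \<Longrightarrow> y \<in> K \<Longrightarrow> \<phi> (x \<otimes> y) = \<phi> x \<otimes> \<phi> y"
  and gal_add: "\<phi> \<in> \<Gamma> \<Longrightarrow> x \<in> K \<Longrightarrow> y \<in> K \<Longrightarrow> \<phi> (x \<oplus> y) = \<phi> x \<oplus> \<phi> y"
  and gal_one: "\<phi> \<in> \<Gamma> \<Longrightarrow> \<phi> \<one> = \<one>"
  using gal_hom[of \<phi>] by (auto simp: ring_hom_def)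

lemma gal_zero: "\<phi> \<in> \<Gamma> \<Longrightarrow> \<phi> \<zero> = \<zero>"
  using gal_fix k_closed(2) by auto

lemma gal_eq_zero: "\<phi> \<in> \<Gamma> \<Longrightarrow> x \<in> K \<Longrightarrow> \<phi> x = \<zero> \<longleftrightarrow> x = \<zero>"
  using gal_bij[of \<phi>] gal_zero[of \<phi>] K_closed(2) by (auto simp: bij_betw_def inj_on_def)

lemma gal_inv:
  assumes "\<phi> \<in> \<Gamma>" "x \<in> K" "x \<noteq> \<zero>"
  shows "\<phi> (inv x) = inv (\<phi> x)"
proof -
  have u: "x \<in> Units \<Omega>" using field_Units K_carrier assms by auto
  have "\<phi> x \<otimes> \<phi> (inv x) = \<one>"
    using gal_mult[of \<phi> x "inv x"] K_inv[OF assms(2,3)] assms gal_one[of \<phi>] Units_r_inv[OF u] by simp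
  then show ?thesis using assms gal_closed K_carrier K_inv by (metis comm_inv_char)
qed

lemma gal_pow: "\<phi> \<in> \<Gamma> \<Longrightarrow> x \<in> K \<Longrightarrow> \<phi> (x [^] (n::nat)) = \<phi> x [^] n"
  by (induction n) (auto simp: gal_one gal_mult K_pow)

lemma gal_finsum: "\<phi> \<in> \<Gamma> \<Longrightarrow> h \<in> A \<rightarrow> K \<Longrightarrow> \<phi> (\<Oplus>a\<in>A. h a) = (\<Oplus>a\<in>A. \<phi> (h a))"
  by (rule hom_finsum_subring[OF subfieldE(1)[OF subfield_K] gal_emb])

lemma gal_finprod:
  assumes "\<phi> \<in> \<Gamma>" "h \<in> A \<rightarrow> K"
  shows "(\<Otimes>a\<in>A. h a) \<in> K \<and> \<phi> (\<Otimes>a\<in>A. h a) = (\<Otimes>a\<in>A. \<phi> (h a))"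
  using assms(2)
proof (induction A rule: infinite_finite_induct)
  case (insert x A)
  have "(\<Otimes>a\<in>insert x A. h a) = h x \<otimes> (\<Otimes>a\<in>A. h a)"
    using insert K_carrier by (intro finprod_insert) auto
  moreover have "(\<Otimes>a\<in>insert x A. \<phi> (h a)) = \<phi> (h x) \<otimes> (\<Otimes>a\<in>A. \<phi> (h a))"
    using insert K_carrier gal_closed[OF assms(1)] by (intro finprod_insert) auto
  ultimately show ?case using insert gal_mult[OF assms(1)] K_closed(6) by auto
qed (auto simp: K_closed gal_one[OF assms(1)])

lemma gal_memI:
  assumes "\<phi> \<in> ring_hom (sub_ring_of \<Omega> K) (sub_ring_of \<Omega> K)" "bij_betw \<phi> K K"
    and "\<And>x. x \<in> k \<Longrightarrow> \<phi> x = x"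
  shows "restrict \<phi> K \<in> \<Gamma>"
  using assms k_subset_K K_closed
  by (auto simp: Gal_def Bij_def ring_hom_def bij_betw_def inj_on_def)

lemma GalGroup_mult:
  assumes "\<phi> \<in> \<Gamma>" "\<psi> \<in> \<Gamma>"
  shows "\<phi> \<otimes>\<^bsub>GalGroup \<Omega> K k\<^esub> \<psi> = compose K \<phi> \<psi>"
  using assms by (auto simp: GalGroup_def BijGroup_def Gal_def)

lemma GalGroup_carrier [simp]: "carrier (GalGroup \<Omega> K k) = \<Gamma>"
  by (simp add: GalGroup_def)

lemma group_GalGroup: "group (GalGroup \<Omega> K k)"
proof -
  have "subgroup \<Gamma> (BijGroup K)"
  proof
    show "\<Gamma> \<subseteq> carrier (BijGroup K)" by (auto simp: Gal_def BijGroup_def)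
    show "\<one>\<^bsub>BijGroup K\<^esub> \<in> \<Gamma>"
      using gal_memI[of "\<lambda>x. x"] by (auto simp: BijGroup_def ring_hom_def bij_betw_def)
  next
    fix \<phi> \<psi> assume *: "\<phi> \<in> \<Gamma>" "\<psi> \<in> \<Gamma>"
    have "bij_betw (\<phi> \<circ> \<psi>) K K" using bij_betw_trans[OF gal_bij[OF *(2)] gal_bij[OF *(1)]] .
    hence "restrict (\<phi> \<circ> \<psi>) K \<in> \<Gamma>"
      using * by (intro gal_memI) (auto simp: ring_hom_def gal_closed gal_mult gal_add gal_one gal_fix)
    moreover have "\<phi> \<otimes>\<^bsub>BijGroup K\<^esub> \<psi> = restrict (\<phi> \<circ> \<psi>) K"
      using * by (auto simp: BijGroup_def Gal_def compose_def)
    ultimately show "\<phi> \<otimes>\<^bsub>BijGroup K\<^esub> \<psi> \<in> \<Gamma>" by simp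
  next
    fix \<phi> assume *: "\<phi> \<in> \<Gamma>"
    let ?i = "inv_into K \<phi>"
    have b: "bij_betw ?i K K" using bij_betw_inv_into[OF gal_bij[OF *]] .
    have cl: "?i x \<in> K" if "x \<in> K" for x using b that by (auto simp: bij_betw_def)
    have r: "\<phi> (?i x) = x" if "x \<in> K" for x
      using bij_betw_inv_into_right[OF gal_bij[OF *] that] .
    have l: "?i (\<phi> x) = x" if "x \<in> K" for x
      using bij_betw_inv_into_left[OF gal_bij[OF *] that] .
    have "?i (x \<otimes> y) = ?i x \<otimes> ?i y" if "x \<in> K" "y \<in> K" for x y
      using l[OF K_closed(6)[OF cl cl], OF that] gal_mult[OF * cl cl, OF that]
      by (simp add: r that)
    moreover have "?i (x \<oplus> y) = ?i x \<oplus> ?i y" if "x \<in> K" "y \<in> K" for x y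
      using l[OF K_closed(7)[OF cl cl], OF that] gal_add[OF * cl cl, OF that]
      by (simp add: r that)
    moreover have "?i x = x" if "x \<in> k" for x
      using l[of x] gal_fix[OF * that] that k_subset_K by auto
    ultimately have "restrict ?i K \<in> \<Gamma>"
      using b cl k_closed(3) by (intro gal_memI) (auto simp: ring_hom_def)
    moreover have "\<phi> \<in> Bij K" using * by (auto simp: Gal_def)
    ultimately show "inv\<^bsub>BijGroup K\<^esub> \<phi> \<in> \<Gamma>" by (simp add: inv_BijGroup)
  qed
  then show ?thesis
    unfolding GalGroup_def by (rule group.subgroup_imp_group[OF group_BijGroup])
qed

lemma gal_comp_mem: "\<phi> \<in> \<Gamma> \<Longrightarrow> \<psi> \<in> \<Gamma> \<Longrightarrow> \<phi> \<otimes>\<^bsub>GalGroup \<Omega> K k\<^esub> \<psi> \<in> \<Gamma>"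
  using monoid.m_closed[OF group.is_monoid[OF group_GalGroup], of \<phi> \<psi>] by simp

lemma gal_comp_apply: "\<phi> \<in> \<Gamma> \<Longrightarrow> \<psi> \<in> \<Gamma> \<Longrightarrow> x \<in> K \<Longrightarrow> (\<phi> \<otimes>\<^bsub>GalGroup \<Omega> K k\<^esub> \<psi>) x = \<phi> (\<psi> x)"
  by (simp add: GalGroup_mult compose_eq)

lemma gal_translate:
  assumes "\<phi> \<in> \<Gamma>"
  shows "(\<lambda>\<tau>. \<phi> \<otimes>\<^bsub>GalGroup \<Omega> K k\<^esub> \<tau>) ` \<Gamma> = \<Gamma>"
    and "inj_on (\<lambda>\<tau>. \<phi> \<otimes>\<^bsub>GalGroup \<Omega> K k\<^esub> \<tau>) \<Gamma>"
  using group.surj_const_mult[OF group_GalGroup, of \<phi>] group.inj_on_cmult[OF group_GalGroup, of \<phi>]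
    assms by auto

lemma gal_inj_restrict: "inj_on (\<lambda>\<phi>. restrict \<phi> K) \<Gamma>"
  by (intro inj_onI) (metis gal_extensional extensional_restrict)

lemma id_in_gal: "restrict id K \<in> \<Gamma>"
  by (intro gal_memI) (auto simp: ring_hom_def bij_betw_def)

lemma embedding_dedekind:
  assumes "finite S" "S \<subseteq> ring_hom (sub_ring_of \<Omega> K) \<Omega>" "inj_on (\<lambda>\<chi>. restrict \<chi> K) S"
    and "a \<in> S \<rightarrow> carrier \<Omega>"
    and "\<And>x. x \<in> K \<Longrightarrow> (\<Oplus>\<chi>\<in>S. a \<chi> \<otimes> \<chi> x) = \<zero>"
  shows "\<forall>\<chi>\<in>S. a \<chi> = \<zero>"
proof (rule dedekind_independence[of "sub_ring_of \<Omega> K"])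
  show "monoid (sub_ring_of \<Omega> K)"
    using subring_is_ring[OF subfieldE(1)[OF subfield_K]] ring.is_monoid by blast
qed (use assms in \<open>auto simp: ring_hom_def hom_def\<close>)

text \<open>
  With more embeddings than \<open>[K:k]\<close>, the values on a basis give fewer equations than unknowns;
  a solution is a linear relation between the embeddings on the whole of \<open>K\<close>, against Dedekind.
\<close>

lemma card_embeddings_le:
  assumes "dimension m k K" "finite S" "S \<subseteq> ring_hom (sub_ring_of \<Omega> K) \<Omega>"
    and "\<And>\<chi> x. \<chi> \<in> S \<Longrightarrow> x \<in> k \<Longrightarrow> \<chi> x = x"
    and "inj_on (\<lambda>\<chi>. restrict \<chi> K) S"
  shows "card S \<le> m"
proof (rule ccontr)
  assume "\<not> card S \<le> m"
  obtain e where e: "e \<in> {..<m} \<rightarrow> K"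
    "\<And>y. y \<in> K \<Longrightarrow> \<exists>a \<in> {..<m} \<rightarrow> k. y = (\<Oplus>i\<in>{..<m}. a i \<otimes> e i)"
    using dimension_imp_basis[OF assms(1) subfield_k] by blast
  have Sc: "\<chi> x \<in> carrier \<Omega>" if "\<chi> \<in> S" "x \<in> K" for \<chi> x
    using assms(3) that by (auto simp: ring_hom_def)
  have ec: "e i \<in> K" if "i < m" for i using e(1) that by auto
  have "\<exists>x. x \<in> S \<rightarrow> carrier \<Omega> \<and> (\<exists>\<chi>\<in>S. x \<chi> \<noteq> \<zero>) \<and>
      (\<forall>i\<in>{..<m}. (\<Oplus>\<chi>\<in>S. \<chi> (e i) \<otimes> x \<chi>) = \<zero>)"
    using \<open>\<not> card S \<le> m\<close> assms(2) Sc ec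
    by (intro underdetermined_system[OF carrier_is_subfield]) auto
  then obtain x where x: "x \<in> S \<rightarrow> carrier \<Omega>" "\<exists>\<chi>\<in>S. x \<chi> \<noteq> \<zero>"
    "\<And>i. i < m \<Longrightarrow> (\<Oplus>\<chi>\<in>S. \<chi> (e i) \<otimes> x \<chi>) = \<zero>"
    by auto
  have xc: "x \<chi> \<in> carrier \<Omega>" if "\<chi> \<in> S" for \<chi> using x(1) that by auto
  have "(\<Oplus>\<chi>\<in>S. x \<chi> \<otimes> \<chi> y) = \<zero>" if y: "y \<in> K" for y
  proof -
    obtain a where a: "a \<in> {..<m} \<rightarrow> k" "y = (\<Oplus>i\<in>{..<m}. a i \<otimes> e i)" using e(2)[OF y] by blast
    have ak: "a i \<in> k" "a i \<in> K" "a i \<in> carrier \<Omega>" if "i < m" for i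
      using a(1) that k_subset_K k_carrier by auto
    have "(\<Oplus>\<chi>\<in>S. x \<chi> \<otimes> \<chi> y) = (\<Oplus>\<chi>\<in>S. \<Oplus>i\<in>{..<m}. a i \<otimes> (\<chi> (e i) \<otimes> x \<chi>))"
    proof (intro finsum_cong')
      fix \<chi> assume chi: "\<chi> \<in> S"
      have "\<chi> y = (\<Oplus>i\<in>{..<m}. \<chi> (a i \<otimes> e i))"
        unfolding a(2) using chi assms(3) ak ec
        by (intro hom_finsum_subring[OF subfieldE(1)[OF subfield_K]]) (auto intro!: K_closed(6))
      also have "\<dots> = (\<Oplus>i\<in>{..<m}. a i \<otimes> \<chi> (e i))"
      proof (intro finsum_cong')
        fix i assume i: "i \<in> {..<m}"
        have "\<chi> \<in> ring_hom (sub_ring_of \<Omega> K) \<Omega>" using chi assms(3) by auto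
        from ring_hom_mult[OF this, of "a i" "e i"]
        show "\<chi> (a i \<otimes> e i) = a i \<otimes> \<chi> (e i)" using i ak ec assms(4)[OF chi] by simp
      qed (use Sc chi ak ec in auto)
      finally have "x \<chi> \<otimes> \<chi> y = x \<chi> \<otimes> (\<Oplus>i\<in>{..<m}. a i \<otimes> \<chi> (e i))" by simp
      also have "\<dots> = (\<Oplus>i\<in>{..<m}. x \<chi> \<otimes> (a i \<otimes> \<chi> (e i)))"
        using xc chi Sc ak ec by (intro finsum_rdistr) auto
      also have "\<dots> = (\<Oplus>i\<in>{..<m}. a i \<otimes> (\<chi> (e i) \<otimes> x \<chi>))"
      proof (intro finsum_cong')
        fix i assume "i \<in> {..<m}"
        then show "x \<chi> \<otimes> (a i \<otimes> \<chi> (e i)) = a i \<otimes> (\<chi> (e i) \<otimes> x \<chi>)"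
          using xc[OF chi] Sc[OF chi ec, of i] ak[of i] by (simp add: m_ac)
      qed (use Sc chi ak ec xc in auto)
      finally show "x \<chi> \<otimes> \<chi> y = (\<Oplus>i\<in>{..<m}. a i \<otimes> (\<chi> (e i) \<otimes> x \<chi>))" .
    qed (use Sc ak ec xc in \<open>auto intro!: finsum_closed\<close>)
    also have "\<dots> = (\<Oplus>i\<in>{..<m}. \<Oplus>\<chi>\<in>S. a i \<otimes> (\<chi> (e i) \<otimes> x \<chi>))"
      using assms(2) Sc ak ec xc by (intro finsum_swap) auto
    also have "\<dots> = (\<Oplus>i\<in>{..<m}. \<zero>)"
    proof (intro finsum_cong')
      fix i assume i: "i \<in> {..<m}"
      have "(\<Oplus>\<chi>\<in>S. a i \<otimes> (\<chi> (e i) \<otimes> x \<chi>)) = a i \<otimes> (\<Oplus>\<chi>\<in>S. \<chi> (e i) \<otimes> x \<chi>)"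
        using i assms(2) Sc ak ec xc by (intro finsum_rdistr[symmetric]) auto
      then show "(\<Oplus>\<chi>\<in>S. a i \<otimes> (\<chi> (e i) \<otimes> x \<chi>)) = \<zero>" using i x(3)[of i] ak by simp
    qed auto
    finally show ?thesis by simp
  qed
  from embedding_dedekind[OF assms(2,3,5) x(1) this] x(2) show False by auto
qed

end

section \<open>Finite Galois extensions\<close>

locale galois_extension = subfield_pair +
  assumes galois: "finite_galois \<Omega> K k"
begin

lemma fixed_field: "x \<in> K \<Longrightarrow> (\<And>\<phi>. \<phi> \<in> \<Gamma> \<Longrightarrow> \<phi> x = x) \<Longrightarrow> x \<in> k"
  using galois unfolding finite_galois_def by blast

lemma dimension_K: obtains m where "dimension m k K"
  using galois unfolding finite_galois_def finite_dimension_def by blast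

lemma finite_gal: "finite \<Gamma>"
proof (rule ccontr)
  assume inf: "infinite \<Gamma>"
  obtain m where m: "dimension m k K" by (rule dimension_K)
  obtain S where S: "finite S" "card S = Suc m" "S \<subseteq> \<Gamma>"
    using infinite_arbitrarily_large[OF inf] by blast
  have "card S \<le> m"
  proof (rule card_embeddings_le[OF m S(1)])
    show "S \<subseteq> ring_hom (sub_ring_of \<Omega> K) \<Omega>" using S(3) gal_emb by blast
    show "\<chi> x = x" if "\<chi> \<in> S" "x \<in> k" for \<chi> x
      by (rule gal_fix) (use that S(3) in auto)
    show "inj_on (\<lambda>\<chi>. restrict \<chi> K) S" by (rule inj_on_subset[OF gal_inj_restrict S(3)])
  qed
  then show False using S(2) by simp
qed

lemma gal_sum_translate:
  assumes "\<phi> \<in> \<Gamma>" "g \<in> \<Gamma> \<rightarrow> carrier \<Omega>"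
  shows "(\<Oplus>\<tau>\<in>\<Gamma>. g (\<phi> \<otimes>\<^bsub>GalGroup \<Omega> K k\<^esub> \<tau>)) = (\<Oplus>\<tau>\<in>\<Gamma>. g \<tau>)"
  using finsum_reindex[of g "\<lambda>\<tau>. \<phi> \<otimes>\<^bsub>GalGroup \<Omega> K k\<^esub> \<tau>" \<Gamma>] gal_translate[OF assms(1)] assms(2)
  by simp

lemma gal_prod_translate:
  assumes "\<phi> \<in> \<Gamma>" "g \<in> \<Gamma> \<rightarrow> carrier \<Omega>"
  shows "(\<Otimes>\<tau>\<in>\<Gamma>. g (\<phi> \<otimes>\<^bsub>GalGroup \<Omega> K k\<^esub> \<tau>)) = (\<Otimes>\<tau>\<in>\<Gamma>. g \<tau>)"
  using finprod_reindex[of g "\<lambda>\<tau>. \<phi> \<otimes>\<^bsub>GalGroup \<Omega> K k\<^esub> \<tau>" \<Gamma>] gal_translate[OF assms(1)] assms(2)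
  by simp

lemma trace_in_base:
  assumes "x \<in> K"
  shows "(\<Oplus>\<tau>\<in>\<Gamma>. \<tau> x) \<in> k"
proof (rule fixed_field)
  show "(\<Oplus>\<tau>\<in>\<Gamma>. \<tau> x) \<in> K"
    using gal_closed assms by (intro finsum_in_subring subfieldE(1)[OF subfield_K]) auto
next
  fix \<phi> assume phi: "\<phi> \<in> \<Gamma>"
  have "\<phi> (\<Oplus>\<tau>\<in>\<Gamma>. \<tau> x) = (\<Oplus>\<tau>\<in>\<Gamma>. \<phi> (\<tau> x))"
    using gal_closed assms phi by (intro gal_finsum) auto
  also have "\<dots> = (\<Oplus>\<tau>\<in>\<Gamma>. (\<phi> \<otimes>\<^bsub>GalGroup \<Omega> K k\<^esub> \<tau>) x)"
    using gal_closed assms phi K_carrier by (intro finsum_cong') (auto simp: gal_comp_apply)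
  also have "\<dots> = (\<Oplus>\<tau>\<in>\<Gamma>. \<tau> x)"
    using gal_closed assms phi K_carrier by (intro gal_sum_translate) auto
  finally show "\<phi> (\<Oplus>\<tau>\<in>\<Gamma>. \<tau> x) = (\<Oplus>\<tau>\<in>\<Gamma>. \<tau> x)" .
qed

text \<open>
  Used with \<open>g = \<one>\<close> for the trace, and with a 1-cocycle \<open>g\<close> for Hilbert 90.
\<close>

lemma twisted_trace_nonzero:
  assumes "g \<in> \<Gamma> \<rightarrow> carrier \<Omega>" "\<phi> \<in> \<Gamma>" "g \<phi> \<noteq> \<zero>"
  obtains (nonzero) x where "x \<in> K" "(\<Oplus>\<tau>\<in>\<Gamma>. g \<tau> \<otimes> \<tau> x) \<noteq> \<zero>"
proof (rule ccontr)
  assume "\<not> thesis"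
  hence "(\<Oplus>\<tau>\<in>\<Gamma>. g \<tau> \<otimes> \<tau> x) = \<zero>" if "x \<in> K" for x using that nonzero by blast
  hence "\<forall>\<tau>\<in>\<Gamma>. g \<tau> = \<zero>"
    using assms(1) gal_emb gal_inj_restrict by (intro embedding_dedekind[OF finite_gal]) auto
  with assms show False by auto
qed

text \<open>
  Only \<open>[K:k] \<le> |Gal(K/k)|\<close> remains (Artin). Otherwise some \<open>x \<noteq> 0\<close> in \<open>K\<^sup>m\<close> satisfies
  \<open>\<Sum>\<^sub>i \<phi>(e\<^sub>i) x\<^sub>i = 0\<close> for all \<open>\<phi>\<close>. Apply \<open>\<tau>\<close> to the \<open>l\<close>-multiple of the equation for \<open>\<phi> = \<tau>\<^sup>-\<^sup>1\<close> and
  sum over \<open>\<tau>\<close>: then \<open>\<Sum>\<^sub>i Tr(l x\<^sub>i) e\<^sub>i = 0\<close>, a relation over \<open>k\<close>, and a suitable \<open>l\<close> makes one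
  of its coefficients nonzero.
\<close>

lemma card_gal:
  assumes m: "dimension m k K"
  shows "card \<Gamma> = m"
proof (rule antisym)
  show "card \<Gamma> \<le> m"
    using gal_emb gal_fix gal_inj_restrict finite_gal by (intro card_embeddings_le[OF m]) auto
  show "m \<le> card \<Gamma>"
  proof (rule ccontr)
    assume "\<not> m \<le> card \<Gamma>"
    obtain e where e: "e \<in> {..<m} \<rightarrow> K"
      "\<And>a. a \<in> {..<m} \<rightarrow> k \<Longrightarrow> (\<Oplus>i\<in>{..<m}. a i \<otimes> e i) = \<zero> \<Longrightarrow> \<forall>i<m. a i = \<zero>"
      using dimension_imp_basis[OF m subfield_k] by blast
    have ec: "e i \<in> K" if "i < m" for i using e(1) that by auto
    have "\<exists>x. x \<in> {..<m} \<rightarrow> K \<and> (\<exists>i\<in>{..<m}. x i \<noteq> \<zero>) \<and>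
        (\<forall>\<phi>\<in>\<Gamma>. (\<Oplus>i\<in>{..<m}. \<phi> (e i) \<otimes> x i) = \<zero>)"
      using \<open>\<not> m \<le> card \<Gamma>\<close> gal_closed ec
      by (intro underdetermined_system[OF subfield_K finite_gal]) auto
    then obtain x where x: "x \<in> {..<m} \<rightarrow> K" "\<exists>j<m. x j \<noteq> \<zero>"
      "\<And>\<phi>. \<phi> \<in> \<Gamma> \<Longrightarrow> (\<Oplus>i\<in>{..<m}. \<phi> (e i) \<otimes> x i) = \<zero>"
      by auto
    have xc: "x i \<in> K" if "i < m" for i using x(1) that by auto
    obtain j where j: "j < m" "x j \<noteq> \<zero>" using x(2) by auto
    obtain t where t: "t \<in> K" "(\<Oplus>\<tau>\<in>\<Gamma>. \<one> \<otimes> \<tau> t) \<noteq> \<zero>"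
      using twisted_trace_nonzero[of "\<lambda>_. \<one>", OF _ id_in_gal] by auto
    \<comment> \<open>The multiplier for which the coefficient at \<open>j\<close> becomes the trace of \<open>t\<close>.\<close>
    define l where "l = t \<otimes> inv (x j)"
    have l: "l \<in> K" using t K_inv[OF xc j(2)] j K_closed(6) by (auto simp: l_def)
    have lx: "l \<otimes> x j = t"
    proof -
      have "x j \<in> Units \<Omega>" "x j \<in> carrier \<Omega>" using field_Units xc j K_carrier by auto
      then show ?thesis using t(1) K_carrier by (simp add: l_def m_assoc)
    qed
    define y where "y i = (\<Oplus>\<tau>\<in>\<Gamma>. \<tau> (l \<otimes> x i))" for i
    have yk: "y i \<in> k" if "i < m" for i
      unfolding y_def using l xc that K_closed(6) by (intro trace_in_base) auto
    have lxc: "\<tau> (l \<otimes> x i) \<in> carrier \<Omega>" if "i < m" "\<tau> \<in> \<Gamma>" for i \<tau>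
      using gal_closed[OF that(2) K_closed(6)[OF l xc[OF that(1)]]] K_carrier by simp
    have "(\<Oplus>i\<in>{..<m}. y i \<otimes> e i) = (\<Oplus>i\<in>{..<m}. \<Oplus>\<tau>\<in>\<Gamma>. \<tau> (l \<otimes> x i) \<otimes> e i)"
    proof (intro finsum_cong')
      fix i assume i: "i \<in> {..<m}"
      then show "y i \<otimes> e i = (\<Oplus>\<tau>\<in>\<Gamma>. \<tau> (l \<otimes> x i) \<otimes> e i)"
        using lxc ec[of i] K_carrier unfolding y_def by (intro finsum_ldistr finite_gal) auto
    qed (use lxc ec K_carrier in \<open>auto intro!: finsum_closed\<close>)
    also have "\<dots> = (\<Oplus>\<tau>\<in>\<Gamma>. \<Oplus>i\<in>{..<m}. \<tau> (l \<otimes> x i) \<otimes> e i)"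
      using ec lxc K_carrier by (intro finsum_swap finite_gal) auto
    also have "\<dots> = (\<Oplus>\<tau>\<in>\<Gamma>. \<zero>)"
    proof (intro finsum_cong')
      fix \<tau> assume tau: "\<tau> \<in> \<Gamma>"
      interpret G: group "GalGroup \<Omega> K k" by (rule group_GalGroup)
      define \<rho> where "\<rho> = inv\<^bsub>GalGroup \<Omega> K k\<^esub> \<tau>"
      have rho: "\<rho> \<in> \<Gamma>" using G.inv_closed[of \<tau>] tau by (simp add: \<rho>_def)
      have tr: "\<tau> (\<rho> z) = z" if "z \<in> K" for z
      proof -
        have "(\<tau> \<otimes>\<^bsub>GalGroup \<Omega> K k\<^esub> \<rho>) = \<one>\<^bsub>GalGroup \<Omega> K k\<^esub>"
          using G.r_inv[of \<tau>] tau by (simp add: \<rho>_def)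
        then show ?thesis using gal_comp_apply[OF tau rho that] that
          by (simp add: GalGroup_def BijGroup_def)
      qed
      have re: "\<rho> (e i) \<in> K" "\<rho> (e i) \<otimes> x i \<in> K" "l \<otimes> (\<rho> (e i) \<otimes> x i) \<in> K"
        if "i < m" for i
        using that ec xc l gal_closed[OF rho] K_closed(6) by auto
      have "(\<Oplus>i\<in>{..<m}. \<tau> (l \<otimes> x i) \<otimes> e i) = (\<Oplus>i\<in>{..<m}. \<tau> (l \<otimes> (\<rho> (e i) \<otimes> x i)))"
      proof (intro finsum_cong')
        fix i assume "i \<in> {..<m}"
        hence i: "i < m" by simp
        have c: "\<tau> l \<in> carrier \<Omega>" "\<tau> (x i) \<in> carrier \<Omega>" "e i \<in> carrier \<Omega>"
          using l xc[OF i] ec[OF i] gal_closed[OF tau] K_carrier by auto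
        have "\<tau> (l \<otimes> (\<rho> (e i) \<otimes> x i)) = \<tau> l \<otimes> (e i \<otimes> \<tau> (x i))"
          using gal_mult[OF tau l re(2)[OF i]] gal_mult[OF tau re(1)[OF i] xc[OF i]] tr[OF ec[OF i]]
          by simp
        moreover have "\<tau> (l \<otimes> x i) = \<tau> l \<otimes> \<tau> (x i)" using gal_mult[OF tau l xc[OF i]] .
        ultimately show "\<tau> (l \<otimes> x i) \<otimes> e i = \<tau> (l \<otimes> (\<rho> (e i) \<otimes> x i))"
          using c by (simp add: m_ac)
      qed (auto intro!: K_carrier gal_closed[OF tau] re)
      also have "\<dots> = \<tau> (\<Oplus>i\<in>{..<m}. l \<otimes> (\<rho> (e i) \<otimes> x i))"
        using re(3) tau by (intro gal_finsum[symmetric]) auto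
      also have "(\<Oplus>i\<in>{..<m}. l \<otimes> (\<rho> (e i) \<otimes> x i)) = l \<otimes> (\<Oplus>i\<in>{..<m}. \<rho> (e i) \<otimes> x i)"
        using re(2) l by (intro finsum_rdistr[symmetric]) (auto intro: K_carrier)
      also have "\<dots> = \<zero>" using x(3)[OF rho] l K_carrier by simp
      finally show "(\<Oplus>i\<in>{..<m}. \<tau> (l \<otimes> x i) \<otimes> e i) = \<zero>" using gal_zero[OF tau] by simp
    qed simp_all
    also have "\<dots> = \<zero>" by (rule add.finprod_one)
    finally have "(\<Oplus>i\<in>{..<m}. y i \<otimes> e i) = \<zero>" .
    moreover have "y \<in> {..<m} \<rightarrow> k" using yk by auto
    ultimately have "y j = \<zero>" using e(2) j(1) by blast
    moreover have "y j = (\<Oplus>\<tau>\<in>\<Gamma>. \<one> \<otimes> \<tau> t)"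
      unfolding y_def lx using t gal_closed K_carrier by (intro finsum_cong') auto
    ultimately show False using t by simp
  qed
qed

text \<open>
  Normality of \<open>K/k\<close> by counting, without minimal polynomials: an embedding outside the
  Galois group would be one more than the \<open>[K:k]\<close> that the dimension allows.
\<close>

lemma embedding_restrict_in_gal:
  assumes "g \<in> ring_hom (sub_ring_of \<Omega> K) \<Omega>" "\<And>x. x \<in> k \<Longrightarrow> g x = x"
  shows "restrict g K \<in> \<Gamma>"
proof (rule ccontr)
  assume neg: "restrict g K \<notin> \<Gamma>"
  obtain m where m: "dimension m k K" by (rule dimension_K)
  let ?S = "insert (restrict g K) \<Gamma>"
  have "restrict g K \<in> ring_hom (sub_ring_of \<Omega> K) \<Omega>"
    using assms(1) K_closed by (auto simp: ring_hom_def)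
  moreover have "inj_on (\<lambda>\<chi>. restrict \<chi> K) ?S"
  proof (intro inj_onI)
    fix \<chi> \<psi> assume *: "\<chi> \<in> ?S" "\<psi> \<in> ?S" "restrict \<chi> K = restrict \<psi> K"
    have "restrict \<rho> K = \<rho>" if "\<rho> \<in> ?S" for \<rho>
      using that gal_extensional by (auto intro: extensional_restrict)
    with * show "\<chi> = \<psi>" by metis
  qed
  ultimately have "card ?S \<le> m"
    using gal_emb gal_fix finite_gal assms(2) k_subset_K by (intro card_embeddings_le[OF m]) auto
  then show False using neg finite_gal card_gal[OF m] by simp
qed

text \<open>
  The element \<open>y = \<Sum>\<^sub>\<tau> g \<tau> \<otimes> \<tau> x\<close> satisfies \<open>g \<phi> \<otimes> \<phi> y = y\<close> by the cocycle identity, and some \<open>x\<close>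
  makes it nonzero; take \<open>F = y\<^sup>-\<^sup>1\<close>.
\<close>

lemma hilbert90:
  assumes g: "g \<in> \<Gamma> \<rightarrow> K - {\<zero>}"
    and cocycle: "\<And>\<phi> \<tau>. \<phi> \<in> \<Gamma> \<Longrightarrow> \<tau> \<in> \<Gamma> \<Longrightarrow> g (\<phi> \<otimes>\<^bsub>GalGroup \<Omega> K k\<^esub> \<tau>) = g \<phi> \<otimes> \<phi> (g \<tau>)"
  obtains F where "F \<in> K - {\<zero>}" "\<And>\<phi>. \<phi> \<in> \<Gamma> \<Longrightarrow> g \<phi> = \<phi> F \<otimes> inv F"
proof -
  have gK: "g \<phi> \<in> K" "g \<phi> \<noteq> \<zero>" if "\<phi> \<in> \<Gamma>" for \<phi> using g that by auto
  obtain x where x: "x \<in> K" "(\<Oplus>\<tau>\<in>\<Gamma>. g \<tau> \<otimes> \<tau> x) \<noteq> \<zero>"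
    using twisted_trace_nonzero[OF _ id_in_gal, of g] gK K_carrier id_in_gal by blast
  define y where "y = (\<Oplus>\<tau>\<in>\<Gamma>. g \<tau> \<otimes> \<tau> x)"
  have yK: "y \<in> K" "y \<noteq> \<zero>"
    using x gK gal_closed K_closed(6) unfolding y_def
    by (auto intro!: finsum_in_subring subfieldE(1)[OF subfield_K])
  have gy: "g \<phi> \<otimes> \<phi> y = y" if phi: "\<phi> \<in> \<Gamma>" for \<phi>
  proof -
    have "\<phi> y = (\<Oplus>\<tau>\<in>\<Gamma>. \<phi> (g \<tau> \<otimes> \<tau> x))"
      unfolding y_def using gK gal_closed K_closed(6) x phi by (intro gal_finsum) auto
    hence "g \<phi> \<otimes> \<phi> y = g \<phi> \<otimes> (\<Oplus>\<tau>\<in>\<Gamma>. \<phi> (g \<tau> \<otimes> \<tau> x))" by simp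
    also have "\<dots> = (\<Oplus>\<tau>\<in>\<Gamma>. g \<phi> \<otimes> \<phi> (g \<tau> \<otimes> \<tau> x))"
      using gK gal_closed K_closed(6) K_carrier x phi finite_gal by (intro finsum_rdistr) auto
    also have "\<dots> = (\<Oplus>\<tau>\<in>\<Gamma>. g (\<phi> \<otimes>\<^bsub>GalGroup \<Omega> K k\<^esub> \<tau>) \<otimes> (\<phi> \<otimes>\<^bsub>GalGroup \<Omega> K k\<^esub> \<tau>) x)"
    proof (intro finsum_cong')
      fix \<tau> assume tau: "\<tau> \<in> \<Gamma>"
      show "g \<phi> \<otimes> \<phi> (g \<tau> \<otimes> \<tau> x) = g (\<phi> \<otimes>\<^bsub>GalGroup \<Omega> K k\<^esub> \<tau>) \<otimes> (\<phi> \<otimes>\<^bsub>GalGroup \<Omega> K k\<^esub> \<tau>) x"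
        using phi tau x gK gal_closed K_carrier
        by (simp add: cocycle gal_mult gal_comp_apply m_assoc)
    qed (use phi x gK gal_closed gal_comp_mem K_carrier in auto)
    also have "\<dots> = y"
      unfolding y_def using phi x gK gal_closed K_carrier
      by (intro gal_sum_translate[of \<phi> "\<lambda>\<tau>. g \<tau> \<otimes> \<tau> x"]) auto
    finally show ?thesis .
  qed
  show thesis
  proof (rule that[of "inv y"])
    show "inv y \<in> K - {\<zero>}" using K_inv yK by auto
    fix \<phi> assume phi: "\<phi> \<in> \<Gamma>"
    have u: "\<phi> y \<in> Units \<Omega>" "y \<in> Units \<Omega>"
      using field_Units gal_eq_zero[OF phi yK(1)] yK gal_closed[OF phi] K_carrier by auto
    have "\<phi> (inv y) \<otimes> inv (inv y) = inv (\<phi> y) \<otimes> y" using gal_inv[OF phi yK] u by simp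
    also have "\<dots> = inv (\<phi> y) \<otimes> (g \<phi> \<otimes> \<phi> y)" using gy[OF phi] by simp
    also have "\<dots> = g \<phi>"
      using u gK[OF phi] K_carrier Units_closed by (simp add: m_lcomm[of _ "g \<phi>"])
    finally show "g \<phi> = \<phi> (inv y) \<otimes> inv (inv y)" by simp
  qed
qed

end

section \<open>Roots in an algebraically closed subfield\<close>

lemma (in algebraically_closed) exists_root_of_poly:
  assumes "p \<in> carrier (poly_ring L)" "0 < degree p"
  shows "\<exists>x\<in>carrier L. eval p x = \<zero>"
proof -
  have "size (roots p) > 0"
    using roots_over_carrier[OF assms(1)] assms(2) unfolding splitted_def by simp
  then obtain x where "x \<in># roots p" by (cases "roots p") auto
  then show ?thesis using roots_mem_iff_is_root[OF assms(1)] by (auto simp: is_root_def)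
qed

lemma (in ring) eval_power_plus_const:
  assumes "x \<in> carrier R" "b \<in> carrier R"
  shows "eval (\<one> # replicate n \<zero> @ [b]) x = x [^] Suc n \<oplus> b"
proof -
  have "eval (replicate n \<zero> @ [b]) x = b"
    using eval_replicate[of "[b]" x n] assms by simp
  then show ?thesis using assms by simp
qed

lemma (in ring) power_plus_const_in_poly_ring:
  assumes "\<one> \<noteq> \<zero>" "subring K R" "b \<in> K"
  shows "\<one> # replicate n \<zero> @ [b] \<in> carrier (K[X])"
  using assms subringE(2,3)[OF assms(2)]
  by (auto simp: univ_poly_carrier[symmetric] polynomial_def)

lemma (in algebraically_closed) exists_nth_root:
  assumes "a \<in> carrier L" "0 < n"
  shows "\<exists>x\<in>carrier L. x [^] (n::nat) = a"
proof -
  obtain l where n: "n = Suc l" using assms(2) gr0_implies_Suc by blast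
  let ?p = "\<one> # replicate l \<zero> @ [\<ominus> a]"
  have "?p \<in> carrier (poly_ring L)"
    using assms by (intro power_plus_const_in_poly_ring carrier_is_subring) auto
  then obtain x where x: "x \<in> carrier L" "eval ?p x = \<zero>"
    using exists_root_of_poly[of ?p] by auto
  have "x [^] n \<oplus> \<ominus> a = \<zero>" using eval_power_plus_const[of x "\<ominus> a" l] x assms n by simp
  hence "x [^] n = a" using x(1) assms(1) minus_equality[of "x [^] n" "\<ominus> a"] by simp
  with x(1) show ?thesis by blast
qed

text \<open>
  The list \<open>replicate n \<one>\<close> is the polynomial \<open>1 + X + \<dots> + X\<^sup>n\<^sup>-\<^sup>1\<close>: its roots are \<open>n\<close>-th roots of
  unity, and in characteristic \<open>0\<close> the root \<open>\<one>\<close> of \<open>X\<^sup>n - 1\<close> is not among them.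
\<close>

lemma (in cring) eval_replicate_one:
  assumes "x \<in> carrier R"
  shows "eval (replicate n \<one>) x \<otimes> (x \<ominus> \<one>) = x [^] n \<ominus> \<one>"
    and "eval (replicate n \<one>) \<one> = [n] \<cdot> \<one>"
proof -
  have c: "eval (replicate n \<one>) x \<in> carrier R" for n
    using assms by (intro eval_in_carrier) auto
  show "eval (replicate n \<one>) x \<otimes> (x \<ominus> \<one>) = x [^] n \<ominus> \<one>"
  proof (induction n)
    case (Suc n)
    have "eval (replicate (Suc n) \<one>) x \<otimes> (x \<ominus> \<one>)
        = (x [^] n \<oplus> eval (replicate n \<one>) x) \<otimes> (x \<ominus> \<one>)" using assms by simp
    also have "\<dots> = x [^] n \<otimes> (x \<ominus> \<one>) \<oplus> eval (replicate n \<one>) x \<otimes> (x \<ominus> \<one>)"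
      using assms c[of n] by (simp add: l_distr)
    also have "\<dots> = x [^] n \<otimes> (x \<ominus> \<one>) \<oplus> (x [^] n \<ominus> \<one>)" using Suc by simp
    also have "\<dots> = x [^] n \<otimes> x \<ominus> \<one>"
    proof -
      have "y \<otimes> (x \<ominus> \<one>) \<oplus> (y \<ominus> \<one>) = y \<otimes> x \<ominus> \<one>" if "y \<in> carrier R" for y
        using that assms by algebra
      then show ?thesis using assms by simp
    qed
    finally show ?case by simp
  qed (use assms in \<open>simp add: minus_eq r_neg\<close>)
  show "eval (replicate n \<one>) \<one> = [n] \<cdot> \<one>"
    by (induction n) (auto simp: a_comm)
qed

lemma (in algebraically_closed) nontrivial_root_of_unity:
  assumes "char_zero L" "1 < e"
  shows "\<exists>x\<in>carrier L. x [^] (e::nat) = \<one> \<and> x \<noteq> \<one>"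
proof -
  have "replicate e \<one> \<in> carrier (poly_ring L)"
    using assms(2) by (auto simp: univ_poly_carrier[symmetric] polynomial_def)
  then obtain x where x: "x \<in> carrier L" "eval (replicate e \<one>) x = \<zero>"
    using exists_root_of_poly[of "replicate e \<one>"] assms(2) by auto
  have "x [^] e \<ominus> \<one> = \<zero>" using eval_replicate_one(1)[OF x(1), of e] x by simp
  hence "x [^] e = \<one>" using x(1) by simp
  moreover have "x \<noteq> \<one>"
    using eval_replicate_one(2)[of \<one> e] x assms(1)[unfolded char_zero_def, rule_format, of e] assms(2)
    by auto
  ultimately show ?thesis using x(1) by blast
qed

text \<open>
  Put \<open>n = g e\<close> and \<open>i = g i'\<close> with \<open>g = gcd n i\<close>. A \<open>g\<close>-th root \<open>x\<close> of a nontrivial \<open>e\<close>-th root of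
  unity \<open>y\<close> works, since \<open>x\<^sup>i = y\<^sup>i\<^sup>'\<close> and \<open>i'\<close> is prime to \<open>e\<close>.
\<close>

lemma (in algebraically_closed) root_of_unity_separates:
  assumes "char_zero L" "0 < n" "\<not> n dvd i"
  shows "\<exists>x\<in>carrier L. x [^] (n::nat) = \<one> \<and> x [^] (i::nat) \<noteq> \<one>"
proof -
  define g where "g = gcd n i"
  obtain e i' where e: "n = g * e" "i = g * i'" "coprime e i'"
    using gcd_coprime_exists[of n i] assms(2) unfolding g_def by (auto simp: mult.commute)
  have g: "0 < g" using assms(2) by (simp add: g_def)
  have "e \<noteq> 0" using e(1) assms(2) by (intro notI) simp
  moreover have "e \<noteq> 1"
  proof
    assume "e = 1"
    hence "n dvd i" unfolding e(1) e(2) by simp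
    with assms(3) show False ..
  qed
  ultimately have e0: "e \<noteq> 0" "e \<noteq> 1" .
  have "1 < e" using e0 by simp
  then obtain y where y: "y \<in> carrier L" "y [^] e = \<one>" "y \<noteq> \<one>"
    using nontrivial_root_of_unity[OF assms(1)] by blast
  obtain x where x: "x \<in> carrier L" "x [^] g = y" using exists_nth_root[OF y(1) g] by blast
  have "x [^] n = \<one>" using x y by (simp add: e(1) nat_pow_pow[symmetric])
  moreover have "x [^] i \<noteq> \<one>"
  proof
    assume "x [^] i = \<one>"
    hence yi: "y [^] i' = \<one>" using x by (simp add: e(2) nat_pow_pow[symmetric])
    obtain a b where ab: "e * a = i' * b + 1"
      using bezout_nat[OF e0(1), of i'] e(3) by auto
    have "y [^] (e * a) = y [^] (i' * b) \<otimes> y" using y(1) ab by (simp add: nat_pow_mult[symmetric])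
    hence "\<one> = \<one> \<otimes> y" using y yi by (simp add: nat_pow_pow[symmetric])
    with y show False by simp
  qed
  ultimately show ?thesis using x(1) by blast
qed

lemma (in field) algebraically_closed_contains_algebraic:
  assumes C: "subfield C R" "algebraically_closed (R\<lparr>carrier := C\<rparr>)"
    and x: "x \<in> carrier R" "(algebraic over C) x"
  shows "x \<in> C"
proof -
  interpret L: algebraically_closed "R\<lparr>carrier := C\<rparr>" by fact
  note irr = IrrE[OF C(1) x]
  note cons = univ_poly_consistent[OF subfieldE(1)[OF C(1)]]
  have p: "Irr C x \<in> carrier (univ_poly (R\<lparr>carrier := C\<rparr>) C)" using irr(1) cons by simp
  have "L.splitted (Irr C x)" using L.roots_over_carrier p by simp
  moreover have "ring_irreducible\<^bsub>univ_poly (R\<lparr>carrier := C\<rparr>) C\<^esub> (Irr C x)"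
    using irr(2) cons by simp
  ultimately have "degree (Irr C x) = 1"
    using L.pirreducible_imp_not_splitted[of "Irr C x"] p by auto
  hence "length (Irr C x) = Suc (Suc 0)" by simp
  then obtain a b where ab: "Irr C x = [a, b]" by (auto simp: length_Suc_conv)
  have set: "set (Irr C x) \<subseteq> C" using irr(1) by (auto simp: univ_poly_carrier[symmetric] polynomial_def)
  hence b: "b \<in> C" "b \<in> carrier R" using ab subringE(1)[OF subfieldE(1)[OF C(1)]] by auto
  have "a = \<one>" using irr(3) ab by simp
  hence "x \<oplus> b = \<zero>" using irr(4) ab x(1) b(2) by simp
  hence "x = \<ominus> b" using x(1) b(2) minus_equality[of x b] by simp
  then show ?thesis using b subringE(5)[OF subfieldE(1)[OF C(1)]] by simp
qed

lemma (in field) algebraic_if_power_in: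
  assumes K: "subfield K R" and x: "x \<in> carrier R" "x [^] (n::nat) \<in> K" "0 < n"
  shows "(algebraic over K) x"
proof -
  obtain l where n: "n = Suc l" using x(3) gr0_implies_Suc by blast
  let ?p = "\<one> # replicate l \<zero> @ [\<ominus> (x [^] n)]"
  show ?thesis
  proof (rule algebraicI[of ?p])
    show "?p \<in> carrier (K[X])"
      using x(2) subringE(5)[OF subfieldE(1)[OF K]]
      by (intro power_plus_const_in_poly_ring subfieldE(1)[OF K]) auto
    show "eval ?p x = \<zero>"
      using eval_power_plus_const[of x "\<ominus> (x [^] n)" l] x(1) unfolding n by (simp add: r_neg)
  qed simp
qed

lemma (in field) finite_nth_roots:
  assumes "0 < n" "a \<in> carrier R"
  shows "finite {x \<in> carrier R. x [^] (n::nat) = a}"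
proof -
  obtain l where n: "n = Suc l" using assms(1) gr0_implies_Suc by blast
  let ?p = "\<one> # replicate l \<zero> @ [\<ominus> a]"
  have "?p \<in> carrier (poly_ring R)"
    using assms by (intro power_plus_const_in_poly_ring carrier_is_subring) auto
  hence "finite {x. is_root ?p x}" by (rule finite_number_of_roots)
  moreover have "{x \<in> carrier R. x [^] n = a} \<subseteq> {x. is_root ?p x}"
    using eval_power_plus_const[of _ "\<ominus> a" l] assms n by (auto simp: is_root_def r_neg)
  ultimately show ?thesis by (rule rev_finite_subset)
qed

section \<open>Radical extensions of a Galois extension\<close>

text \<open>
  \<open>twist_root\<close> is what makes \<open>K(w)\<close> normal over \<open>k\<close>; \<open>separating_root\<close> says in a form without
  orders that \<open>K\<close> contains enough \<open>n\<close>-th roots of unity.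
\<close>

locale kummer_extension = galois_extension +
  fixes n :: nat and F w
  assumes n_pos: "0 < n"
    and F: "F \<in> K" "F \<noteq> \<zero>"
    and w: "w \<in> carrier \<Omega>" "w [^] n = F"
    and twist_root: "\<And>\<phi>. \<phi> \<in> \<Gamma> \<Longrightarrow> \<exists>u\<in>K. u [^] n \<otimes> F = \<phi> F"
    and separating_root: "\<And>i::nat. \<not> n dvd i \<Longrightarrow> \<exists>\<zeta>\<in>K. \<zeta> [^] n = \<one> \<and> \<zeta> [^] i \<noteq> \<one>"
    and char_0: "\<And>N::nat. 0 < N \<Longrightarrow> [N] \<cdot> \<one> \<noteq> \<zero>"
begin

abbreviation "KR \<equiv> sub_ring_of \<Omega> K"
abbreviation "P \<equiv> UP (sub_ring_of \<Omega> K)"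
abbreviation "K' \<equiv> simple_extension K w"

lemma w_algebraic: "(algebraic over K) w"
  using algebraic_if_power_in[OF subfield_K w(1) _ n_pos] w(2) F by simp

lemma subfield_K': "subfield K' \<Omega>"
  using simple_extension_is_subfield[OF subfield_K w(1)] w_algebraic by simp

lemma K_subset_K': "K \<subseteq> K'"
  by (rule simple_extension_incl[OF K_closed(1) w(1)])

lemma w_in_K': "w \<in> K'"
  by (rule simple_extension_mem[OF subfieldE(1)[OF subfield_K] w(1)])

lemma K'_subset: "subfield E \<Omega> \<Longrightarrow> K \<subseteq> E \<Longrightarrow> w \<in> E \<Longrightarrow> K' \<subseteq> E"
  by (intro simple_extension_subring_incl subfieldE(1))

lemma finite_dimension_K': "finite_dimension k K'"
proof (rule telescopic_base_dim(1)[OF subfield_k subfield_K])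
  show "finite_dimension k K" using galois unfolding finite_galois_def by blast
  show "finite_dimension K K'"
    using finite_dimension_simple_extension[OF subfield_K w(1)] w_algebraic by simp
qed

sublocale E: subfield_pair \<Omega> K' k
proof (intro subfield_pair.intro subfield_pair_axioms.intro field_axioms)
  show "subfield K' \<Omega>" by (rule subfield_K')
  show "subfield k \<Omega>" by (rule subfield_k)
  show "k \<subseteq> K'" by (rule subset_trans[OF k_subset_K K_subset_K'])
qed

text \<open>
  The pair \<open>(\<phi>, u)\<close> stands for the ring automorphism of \<open>K[X]\<close> that is \<open>\<phi>\<close> on coefficients and
  maps \<open>X\<close> to \<open>u X\<close>. The condition on \<open>u\<close> says that it preserves the ideal of \<open>X\<^sup>n - F\<close>.
\<close>

definition twists :: "(('a \<Rightarrow> 'a) \<times> 'a) set" where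
  "twists = {(\<phi>, u). \<phi> \<in> \<Gamma> \<and> u \<in> K \<and> u [^] n \<otimes> F = \<phi> F}"

definition id_twist :: "('a \<Rightarrow> 'a) \<times> 'a" where
  "id_twist = (restrict id K, \<one>)"

text \<open>The action of the twist on \<open>K[X]\<close> followed by evaluation at \<open>w\<close>.\<close>

definition ev :: "('a \<Rightarrow> 'a) \<times> 'a \<Rightarrow> (nat \<Rightarrow> 'a) \<Rightarrow> 'a" where
  "ev g = UnivPoly.eval KR \<Omega> (fst g) (snd g \<otimes> w)"

lemma twistsD:
  assumes "g \<in> twists"
  shows "fst g \<in> \<Gamma>" "snd g \<in> K" "snd g [^] n \<otimes> F = fst g F" "snd g \<noteq> \<zero>"
proof -
  show *: "fst g \<in> \<Gamma>" "snd g \<in> K" "snd g [^] n \<otimes> F = fst g F"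
    using assms by (auto simp: twists_def)
  show "snd g \<noteq> \<zero>"
    using * gal_eq_zero[OF *(1) F(1)] F n_pos K_carrier by (auto simp: nat_pow_zero)
qed

lemma root_of_unity_twist: "\<zeta> \<in> K \<Longrightarrow> \<zeta> [^] n = \<one> \<Longrightarrow> (restrict id K, \<zeta>) \<in> twists"
  using id_in_gal F K_carrier by (auto simp: twists_def)

lemma id_twist: "id_twist \<in> twists"
  unfolding id_twist_def by (rule root_of_unity_twist) (auto simp: K_closed)

lemma finite_twists: "finite twists"
proof -
  have "finite {u \<in> K. u [^] n \<otimes> F = \<phi> F}" if phi: "\<phi> \<in> \<Gamma>" for \<phi>
  proof (rule finite_subset)
    have Fu: "F \<in> Units \<Omega>" "F \<in> carrier \<Omega>" "\<phi> F \<in> carrier \<Omega>"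
      using F K_carrier field_Units gal_closed[OF phi] by auto
    show "finite {x \<in> carrier \<Omega>. x [^] n = \<phi> F \<otimes> inv F}"
      using Fu by (intro finite_nth_roots n_pos) auto
    have "u [^] n = \<phi> F \<otimes> inv F" if "u \<in> K" "u [^] n \<otimes> F = \<phi> F" for u
      using Fu K_carrier[OF that(1)] by (simp add: that(2)[symmetric] m_assoc)
    then show "{u \<in> K. u [^] n \<otimes> F = \<phi> F} \<subseteq> {x \<in> carrier \<Omega>. x [^] n = \<phi> F \<otimes> inv F}"
      using K_carrier by auto
  qed
  moreover have "twists = (SIGMA \<phi>:\<Gamma>. {u \<in> K. u [^] n \<otimes> F = \<phi> F})" by (auto simp: twists_def)
  ultimately show ?thesis using finite_gal by auto
qed

lemma UP_eval: "g \<in> twists \<Longrightarrow> UP_pre_univ_prop KR \<Omega> (fst g)"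
proof -
  assume "g \<in> twists"
  interpret R: field KR by (rule subfield_iff(2)[OF subfield_K])
  show ?thesis
    by unfold_locales (rule gal_emb[OF twistsD(1)[OF \<open>g \<in> twists\<close>]])
qed

sublocale PR: UP_cring KR P
proof -
  interpret R: field KR by (rule subfield_iff(2)[OF subfield_K])
  show "UP_cring KR" by unfold_locales
qed

lemma coeff_K: "p \<in> carrier P \<Longrightarrow> up_ring.coeff P p i \<in> K"
  using PR.coeff_closed[of p i] by simp

lemma twist_w_carrier: "g \<in> twists \<Longrightarrow> snd g \<otimes> w \<in> carrier \<Omega>"
  using twistsD(2) K_carrier w by auto

lemma ev_hom: "g \<in> twists \<Longrightarrow> ev g \<in> ring_hom P \<Omega>"
  unfolding ev_def by (rule UP_pre_univ_prop.eval_ring_hom[OF UP_eval twist_w_carrier])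

lemma ev_carrier: "g \<in> twists \<Longrightarrow> p \<in> carrier P \<Longrightarrow> ev g p \<in> carrier \<Omega>"
  by (rule ring_hom_closed[OF ev_hom])

lemma ev_mult: "g \<in> twists \<Longrightarrow> p \<in> carrier P \<Longrightarrow> q \<in> carrier P \<Longrightarrow> ev g (p \<otimes>\<^bsub>P\<^esub> q) = ev g p \<otimes> ev g q"
  by (rule ring_hom_mult[OF ev_hom])

lemma ev_add: "g \<in> twists \<Longrightarrow> p \<in> carrier P \<Longrightarrow> q \<in> carrier P \<Longrightarrow> ev g (p \<oplus>\<^bsub>P\<^esub> q) = ev g p \<oplus> ev g q"
  by (rule ring_hom_add[OF ev_hom])

lemma ev_one: "g \<in> twists \<Longrightarrow> ev g \<one>\<^bsub>P\<^esub> = \<one>"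
  by (rule ring_hom_one[OF ev_hom])

lemma ev_zero: "g \<in> twists \<Longrightarrow> ev g \<zero>\<^bsub>P\<^esub> = \<zero>"
  by (rule ring_hom_zero[OF ev_hom PR.P.ring_axioms ring_axioms])

lemma ev_minus:
  assumes "g \<in> twists" "p \<in> carrier P" "q \<in> carrier P"
  shows "ev g (p \<ominus>\<^bsub>P\<^esub> q) = ev g p \<ominus> ev g q"
proof -
  interpret h: ring_hom_cring P \<Omega> "ev g"
    using ev_hom[OF assms(1)] by unfold_locales
  show ?thesis using assms by (simp add: PR.P.minus_eq minus_eq)
qed

lemma ev_const: "g \<in> twists \<Longrightarrow> a \<in> K \<Longrightarrow> ev g (up_ring.monom P a 0) = fst g a"
  unfolding ev_def using UP_pre_univ_prop.eval_const[OF UP_eval twist_w_carrier, of g g a] by simp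

lemma ev_monom1:
  assumes "g \<in> twists" "a \<in> K"
  shows "ev g (up_ring.monom P a 1) = fst g a \<otimes> (snd g \<otimes> w)"
  unfolding ev_def using UP_pre_univ_prop.eval_monom[OF UP_eval _ twist_w_carrier, of g a g 1] assms
    twist_w_carrier[OF assms(1)] by simp

lemma ev_sum:
  assumes "g \<in> twists" "p \<in> carrier P"
  shows "ev g p = (\<Oplus>i\<in>{..deg KR p}. (fst g (up_ring.coeff P p i) \<otimes> snd g [^] i) \<otimes> w [^] i)"
proof -
  have "ev g p = (\<Oplus>i\<in>{..deg KR p}. fst g (up_ring.coeff P p i) \<otimes> (snd g \<otimes> w) [^] i)"
    unfolding ev_def by (rule PR.eval_on_carrier[OF assms(2)])
  also have "\<dots> = (\<Oplus>i\<in>{..deg KR p}. (fst g (up_ring.coeff P p i) \<otimes> snd g [^] i) \<otimes> w [^] i)"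
    using twistsD[OF assms(1)] gal_closed[OF twistsD(1)[OF assms(1)]] coeff_K[OF assms(2)] K_carrier w
    by (intro finsum_cong') (auto simp: nat_pow_distrib m_assoc)
  finally show ?thesis .
qed

lemma ev_in_K':
  assumes "g \<in> twists" "p \<in> carrier P"
  shows "ev g p \<in> K'"
proof -
  have "(fst g (up_ring.coeff P p i) \<otimes> snd g [^] i) \<otimes> w [^] i \<in> K'" for i
  proof -
    have "fst g (up_ring.coeff P p i) \<in> K'" "snd g \<in> K'"
      using gal_closed[OF twistsD(1)[OF assms(1)] coeff_K[OF assms(2)]] twistsD[OF assms(1)] K_subset_K'
      by auto
    then show ?thesis using E.K_pow w_in_K' by (intro E.K_closed(6))
  qed
  then show ?thesis
    unfolding ev_sum[OF assms] by (intro finsum_in_subring subfieldE(1)[OF subfield_K']) auto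
qed

lemma ev_surj:
  assumes g: "g \<in> twists" and "y \<in> K'"
  shows "\<exists>p\<in>carrier P. ev g p = y"
  using assms(2)
proof (induction rule: simple_extension.induct)
  case zero
  then show ?case using ev_zero[OF g] PR.P.zero_closed by blast
next
  case (lin k1 k2)
  obtain p where p: "p \<in> carrier P" "ev g p = k1" using lin by blast
  have surj: "\<exists>b\<in>K. fst g b = a" if "a \<in> K" for a
    using gal_bij[OF twistsD(1)[OF g]] that by (metis bij_betw_def imageE)
  note u = twistsD(2,4)[OF g]
  obtain a where a: "a \<in> K" "fst g a = inv (snd g)" using surj K_inv[OF u] by blast
  obtain b where b: "b \<in> K" "fst g b = k2" using surj lin by blast
  have c: "up_ring.monom P a 1 \<in> carrier P" "up_ring.monom P b 0 \<in> carrier P"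
    using a b by (auto intro!: PR.monom_closed)
  have "snd g \<in> Units \<Omega>" "snd g \<in> carrier \<Omega>" using u field_Units K_carrier by auto
  hence "ev g (up_ring.monom P a 1) = w"
    unfolding ev_monom1[OF g a(1)] a(2) using w by (simp add: m_assoc[symmetric])
  hence "ev g (p \<otimes>\<^bsub>P\<^esub> up_ring.monom P a 1 \<oplus>\<^bsub>P\<^esub> up_ring.monom P b 0) = k1 \<otimes> w \<oplus> k2"
    using c p b by (simp add: ev_add[OF g] ev_mult[OF g] ev_const[OF g])
  then show ?case using c p by blast
qed

lemma twist_translate:
  assumes h: "h \<in> twists"
  defines "T \<equiv> \<lambda>g. (fst h \<otimes>\<^bsub>GalGroup \<Omega> K k\<^esub> fst g, fst h (snd g) \<otimes> snd h)"
  shows "inj_on T twists" "T ` twists = twists"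
proof -
  note h' = twistsD[OF h]
  show inj: "inj_on T twists"
  proof (rule inj_onI)
    fix g g' assume g: "g \<in> twists" "g' \<in> twists" and eq: "T g = T g'"
    note gg = twistsD[OF g(1)] twistsD[OF g(2)]
    have "fst g = fst g'"
      using eq inj_onD[OF gal_translate(2)[OF h'(1)], of "fst g" "fst g'"] gg unfolding T_def by simp
    moreover have "fst h (snd g) = fst h (snd g')"
      using eq m_rcancel[of "snd h" "fst h (snd g)" "fst h (snd g')"] h' gg gal_closed[OF h'(1)] K_carrier
      unfolding T_def by auto
    hence "snd g = snd g'"
      using gal_bij[OF h'(1)] gg by (auto simp: bij_betw_def inj_on_def)
    ultimately show "g = g'" by (rule prod_eqI)
  qed
  have "T g \<in> twists" if g: "g \<in> twists" for g
  proof -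
    note g' = twistsD[OF g]
    have c: "fst h (snd g) \<in> K" "fst h (snd g) \<in> carrier \<Omega>" "snd h \<in> carrier \<Omega>" "F \<in> carrier \<Omega>"
      using gal_closed[OF h'(1)] g' h' K_carrier F by auto
    have "(fst h (snd g) \<otimes> snd h) [^] n \<otimes> F = fst h (snd g) [^] n \<otimes> (snd h [^] n \<otimes> F)"
      using c by (simp add: nat_pow_distrib m_assoc)
    also have "\<dots> = fst h (snd g [^] n \<otimes> F)"
      using gal_mult[OF h'(1) K_pow[OF g'(2)] F(1)] gal_pow[OF h'(1) g'(2)] h'(3) by simp
    also have "\<dots> = (fst h \<otimes>\<^bsub>GalGroup \<Omega> K k\<^esub> fst g) F"
      using gal_comp_apply[OF h'(1) g'(1) F(1)] g' by simp
    finally show ?thesis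
      using gal_comp_mem[OF h'(1) g'(1)] c h' K_closed(6) unfolding T_def twists_def by simp
  qed
  with inj show "T ` twists = twists"
    by (intro endo_inj_surj finite_twists) auto
qed

text \<open>
  Composition with \<open>h\<close> permutes the twists, so the sum of \<open>g \<cdot> p\<close> over all twists \<open>g\<close> is invariant
  under \<open>h\<close>; this is the coefficient of degree \<open>i\<close> of that identity.
\<close>

lemma trace_coeff_invariant:
  fixes i :: nat
  assumes "a \<in> K" and h: "h \<in> twists"
  defines "A \<equiv> (\<Oplus>g\<in>twists. fst g a \<otimes> snd g [^] i)"
  shows "A \<in> K" and "fst h A \<otimes> snd h [^] i = A"
proof -
  have t: "fst g a \<otimes> snd g [^] i \<in> K" if "g \<in> twists" for g
    using gal_closed[OF twistsD(1)[OF that] assms(1)] twistsD(2)[OF that] K_pow K_closed(6) by simp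
  show AK: "A \<in> K"
    unfolding A_def using t by (intro finsum_in_subring subfieldE(1)[OF subfield_K]) auto
  note h' = twistsD[OF h]
  let ?T = "\<lambda>g. (fst h \<otimes>\<^bsub>GalGroup \<Omega> K k\<^esub> fst g, fst h (snd g) \<otimes> snd h)"
  have T: "?T g \<in> twists" if "g \<in> twists" for g using twist_translate(2)[OF h] that by blast
  have hi: "snd h [^] i \<in> carrier \<Omega>" using h' K_carrier by simp
  have ht: "fst h (fst g a \<otimes> snd g [^] i) \<in> carrier \<Omega>" if "g \<in> twists" for g
    using K_carrier gal_closed[OF h'(1) t[OF that]] by simp
  have "fst h A \<otimes> snd h [^] i = (\<Oplus>g\<in>twists. fst h (fst g a \<otimes> snd g [^] i)) \<otimes> snd h [^] i"
    unfolding A_def using t by (subst gal_finsum[OF h'(1)]) auto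
  also have "\<dots> = (\<Oplus>g\<in>twists. fst h (fst g a \<otimes> snd g [^] i) \<otimes> snd h [^] i)"
    using ht hi by (intro finsum_ldistr finite_twists) auto
  also have "\<dots> = (\<Oplus>g\<in>twists. fst (?T g) a \<otimes> snd (?T g) [^] i)"
  proof (intro finsum_cong')
    fix g assume g: "g \<in> twists"
    note g' = twistsD[OF g]
    have "fst g a \<in> K" "snd g [^] i \<in> K" using gal_closed[OF g'(1) assms(1)] g' K_pow by auto
    moreover from this have "fst h (fst g a) \<in> carrier \<Omega>" "fst h (snd g) \<in> carrier \<Omega>" "snd h \<in> carrier \<Omega>"
      using gal_closed[OF h'(1)] K_carrier h' g' by auto
    ultimately show "fst h (fst g a \<otimes> snd g [^] i) \<otimes> snd h [^] i = fst (?T g) a \<otimes> snd (?T g) [^] i"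
      using gal_mult[OF h'(1)] gal_pow[OF h'(1) g'(2)] gal_comp_apply[OF h'(1) g'(1) assms(1)]
      by (simp add: nat_pow_distrib m_assoc)
  qed (use t[OF T] K_carrier in auto)
  also have "\<dots> = (\<Oplus>g\<in>?T ` twists. fst g a \<otimes> snd g [^] i)"
    using t T K_carrier twist_translate(1)[OF h]
    by (intro finsum_reindex[of "\<lambda>g. fst g a \<otimes> snd g [^] i" ?T, symmetric]) auto
  also have "\<dots> = A" unfolding twist_translate(2)[OF h] A_def ..
  finally show "fst h A \<otimes> snd h [^] i = A" .
qed

text \<open>
  Invariance under the twist by a root of unity \<open>\<zeta>\<close> with \<open>\<zeta>\<^sup>i \<noteq> 1\<close> kills the coefficients whose
  degree \<open>i\<close> is not divisible by \<open>n\<close>. For \<open>i = n j\<close> the term is \<open>A F\<^sup>j\<close>, and the relation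
  \<open>u\<^sup>n F = \<phi> F\<close> turns invariance of \<open>A\<close> under \<open>(\<phi>, u)\<close> into invariance of \<open>A F\<^sup>j\<close> under \<open>\<phi>\<close>.
\<close>

lemma trace_term_in_base:
  assumes "a \<in> K"
  shows "(\<Oplus>g\<in>twists. fst g a \<otimes> snd g [^] (i::nat)) \<otimes> w [^] i \<in> k"
proof -
  define A where "A = (\<Oplus>g\<in>twists. fst g a \<otimes> snd g [^] i)"
  have AK: "A \<in> K" using trace_coeff_invariant(1)[OF assms id_twist] by (simp add: A_def)
  have inv: "fst h A \<otimes> snd h [^] i = A" if "h \<in> twists" for h
    using trace_coeff_invariant(2)[OF assms that, of i] by (simp add: A_def)
  have "A \<otimes> w [^] i \<in> k"
  proof (cases "n dvd i")
    case False
    then obtain \<zeta> where z: "\<zeta> \<in> K" "\<zeta> [^] n = \<one>" "\<zeta> [^] i \<noteq> \<one>" using separating_root by blast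
    have "A \<otimes> \<zeta> [^] i = A" using inv[OF root_of_unity_twist[OF z(1,2)]] AK by simp
    hence "A \<otimes> \<zeta> [^] i = A \<otimes> \<one>" using AK K_carrier by simp
    hence "A = \<zero>"
      using m_lcancel[of A "\<zeta> [^] i" \<one>] AK z K_carrier by auto
    then show ?thesis using w k_closed(2) by simp
  next
    case True
    then obtain j where i: "i = n * j" by auto
    have wi: "w [^] i = F [^] j" using w by (simp add: i nat_pow_pow[symmetric])
    show ?thesis unfolding wi
    proof (rule fixed_field)
      show "A \<otimes> F [^] j \<in> K" using AK F K_pow K_closed(6) by simp
      fix \<phi> assume phi: "\<phi> \<in> \<Gamma>"
      obtain u where u: "u \<in> K" "u [^] n \<otimes> F = \<phi> F" using twist_root[OF phi] by blast
      have h: "(\<phi>, u) \<in> twists" using phi u by (simp add: twists_def)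
      have c: "\<phi> A \<in> carrier \<Omega>" "u \<in> carrier \<Omega>" "F \<in> carrier \<Omega>"
        using gal_closed[OF phi AK] u F K_carrier by auto
      have "\<phi> (A \<otimes> F [^] j) = \<phi> A \<otimes> (u [^] n \<otimes> F) [^] j"
        using gal_mult[OF phi AK] gal_pow[OF phi F(1)] F K_pow u by simp
      also have "\<dots> = (\<phi> A \<otimes> u [^] i) \<otimes> F [^] j"
        using c by (simp add: nat_pow_distrib nat_pow_pow i m_assoc)
      also have "\<dots> = A \<otimes> F [^] j" using inv[OF h] by simp
      finally show "\<phi> (A \<otimes> F [^] j) = A \<otimes> F [^] j" .
    qed
  qed
  then show ?thesis by (simp add: A_def)
qed

lemma ev_trace_in_base:
  assumes p: "p \<in> carrier P"
  shows "(\<Oplus>g\<in>twists. ev g p) \<in> k"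
proof -
  let ?t = "\<lambda>g i. fst g (up_ring.coeff P p i) \<otimes> snd g [^] i"
  have c: "?t g i \<in> carrier \<Omega>" if "g \<in> twists" for g i
    using gal_closed[OF twistsD(1)[OF that] coeff_K[OF p]] twistsD(2)[OF that] K_carrier by simp
  have wc: "w [^] i \<in> carrier \<Omega>" for i :: nat using w by simp
  have "(\<Oplus>g\<in>twists. ev g p) = (\<Oplus>g\<in>twists. \<Oplus>i\<in>{..deg KR p}. ?t g i \<otimes> w [^] i)"
    using c wc by (intro finsum_cong' ev_sum p) (auto intro!: finsum_closed)
  also have "\<dots> = (\<Oplus>i\<in>{..deg KR p}. \<Oplus>g\<in>twists. ?t g i \<otimes> w [^] i)"
    using c wc by (intro finsum_swap finite_twists) auto
  also have "\<dots> = (\<Oplus>i\<in>{..deg KR p}. (\<Oplus>g\<in>twists. ?t g i) \<otimes> w [^] i)"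
  proof (intro finsum_cong')
    fix i
    show "(\<Oplus>g\<in>twists. ?t g i \<otimes> w [^] i) = (\<Oplus>g\<in>twists. ?t g i) \<otimes> w [^] i"
      using c wc by (intro finsum_ldistr[symmetric] finite_twists) auto
  qed (use c wc in \<open>auto intro!: finsum_closed\<close>)
  also have "\<dots> \<in> k"
    using trace_term_in_base[OF coeff_K[OF p]]
    by (intro finsum_in_subring subfieldE(1)[OF subfield_k]) auto
  finally show ?thesis .
qed

text \<open>
  Both evaluations map onto \<open>K'\<close>, so an inclusion of their kernels gives a ring map
  \<open>K' \<rightarrow> K'\<close>; it is injective because \<open>K'\<close> is a field.
\<close>

lemma twist_induces_automorphism:
  assumes g: "g \<in> twists"
    and ker: "\<And>p. p \<in> carrier P \<Longrightarrow> ev g p = \<zero> \<Longrightarrow> ev id_twist p = \<zero>"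
  shows "\<exists>\<alpha>\<in>Gal \<Omega> K' k. \<forall>p\<in>carrier P. \<alpha> (ev g p) = ev id_twist p"
proof -
  define \<alpha> where "\<alpha> y = ev id_twist (SOME p. p \<in> carrier P \<and> ev g p = y)" for y
  have wd: "\<alpha> (ev g p) = ev id_twist p" if p: "p \<in> carrier P" for p
  proof -
    define q where "q = (SOME q. q \<in> carrier P \<and> ev g q = ev g p)"
    have q: "q \<in> carrier P" "ev g q = ev g p"
      unfolding q_def using someI[of "\<lambda>q. q \<in> carrier P \<and> ev g q = ev g p" p] p by auto
    have "ev g (q \<ominus>\<^bsub>P\<^esub> p) = \<zero>"
      using ev_minus[OF g q(1) p] q(2) ev_carrier[OF g p] by simp
    hence "ev id_twist (q \<ominus>\<^bsub>P\<^esub> p) = \<zero>" using ker[OF PR.P.minus_closed[OF q(1) p]] by simp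
    hence "ev id_twist q = ev id_twist p"
      using ev_minus[OF id_twist q(1) p] ev_carrier[OF id_twist p] ev_carrier[OF id_twist q(1)] by simp
    then show ?thesis by (simp add: \<alpha>_def q_def)
  qed
  have lift: "\<exists>p\<in>carrier P. ev g p = y" if "y \<in> K'" for y using ev_surj[OF g that] .
  have mult: "\<alpha> (x \<otimes> y) = \<alpha> x \<otimes> \<alpha> y" and add: "\<alpha> (x \<oplus> y) = \<alpha> x \<oplus> \<alpha> y"
    if xy: "x \<in> K'" "y \<in> K'" for x y
  proof -
    obtain p q where p: "p \<in> carrier P" "ev g p = x" and q: "q \<in> carrier P" "ev g q = y"
      using lift xy by metis
    have "\<alpha> (x \<otimes> y) = ev id_twist (p \<otimes>\<^bsub>P\<^esub> q)"
      using wd[OF PR.P.m_closed[OF p(1) q(1)]] ev_mult[OF g p(1) q(1)] p q by simp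
    then show "\<alpha> (x \<otimes> y) = \<alpha> x \<otimes> \<alpha> y"
      using ev_mult[OF id_twist p(1) q(1)] wd[OF p(1)] wd[OF q(1)] p q by simp
    have "\<alpha> (x \<oplus> y) = ev id_twist (p \<oplus>\<^bsub>P\<^esub> q)"
      using wd[OF PR.P.add.m_closed[OF p(1) q(1)]] ev_add[OF g p(1) q(1)] p q by simp
    then show "\<alpha> (x \<oplus> y) = \<alpha> x \<oplus> \<alpha> y"
      using ev_add[OF id_twist p(1) q(1)] wd[OF p(1)] wd[OF q(1)] p q by simp
  qed
  have const: "\<alpha> a = a" if a: "a \<in> k" for a
  proof -
    have "a \<in> K" using a k_subset_K by auto
    hence m: "up_ring.monom P a 0 \<in> carrier P" by (intro PR.monom_closed) auto
    have "ev g (up_ring.monom P a 0) = a" "ev id_twist (up_ring.monom P a 0) = a"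
      using ev_const[OF g \<open>a \<in> K\<close>] ev_const[OF id_twist \<open>a \<in> K\<close>]
        gal_fix[OF twistsD(1)[OF g] a] gal_fix[OF twistsD(1)[OF id_twist] a] by auto
    then show ?thesis using wd[OF m] by simp
  qed
  have cl: "\<alpha> y \<in> K'" if "y \<in> K'" for y
    using lift[OF that] wd ev_in_K'[OF id_twist] by metis
  have one: "\<alpha> \<one> = \<one>" by (rule const) (rule k_closed(3))
  have "\<alpha> ` K' = K'"
  proof
    show "\<alpha> ` K' \<subseteq> K'" using cl by auto
    show "K' \<subseteq> \<alpha> ` K'"
    proof
      fix y assume "y \<in> K'"
      then obtain p where "p \<in> carrier P" "ev id_twist p = y" using ev_surj[OF id_twist] by blast
      then show "y \<in> \<alpha> ` K'" using wd ev_in_K'[OF g] by (metis imageI)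
    qed
  qed
  moreover have "inj_on \<alpha> K'"
  proof (rule inj_onI)
    fix x y assume xy: "x \<in> K'" "y \<in> K'" "\<alpha> x = \<alpha> y"
    have c: "x \<in> carrier \<Omega>" "y \<in> carrier \<Omega>" "\<alpha> y \<in> carrier \<Omega>"
      using xy cl E.K_carrier by auto
    define d where "d = x \<ominus> y"
    have d: "d \<in> K'" using xy E.K_closed(5,7) by (simp add: d_def minus_eq)
    have "x = d \<oplus> y" using c unfolding d_def by algebra
    hence "\<alpha> d \<oplus> \<alpha> y = \<alpha> y" using add[OF d xy(2)] xy(3) by simp
    hence ad: "\<alpha> d = \<zero>" using c(3) cl[OF d] E.K_carrier by simp
    have "d = \<zero>"
    proof (rule ccontr)
      assume "d \<noteq> \<zero>"
      hence "inv d \<in> K'" "d \<otimes> inv d = \<one>"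
        using E.K_inv[OF d] field_Units E.K_carrier[OF d] by auto
      hence "\<one> = \<zero>" using mult[OF d \<open>inv d \<in> K'\<close>] ad one cl E.K_carrier by simp
      then show False by simp
    qed
    with \<open>x = d \<oplus> y\<close> c show "x = y" by simp
  qed
  ultimately have "bij_betw \<alpha> K' K'" by (simp add: bij_betw_def)
  moreover have "\<alpha> \<in> ring_hom (sub_ring_of \<Omega> K') (sub_ring_of \<Omega> K')"
    using cl mult add one by (auto simp: ring_hom_def)
  ultimately have "restrict \<alpha> K' \<in> Gal \<Omega> K' k" using const by (intro E.gal_memI)
  moreover have "restrict \<alpha> K' (ev g p) = ev id_twist p" if "p \<in> carrier P" for p
    using wd[OF that] ev_in_K'[OF g that] by simp
  ultimately show ?thesis by blast
qed

text \<open>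
  Primality of the kernel of \<open>ev id_twist\<close>: a product of elements outside it is outside it.
\<close>

lemma separating_poly:
  assumes "finite T" "T \<subseteq> twists"
    and "\<And>g. g \<in> T \<Longrightarrow> \<exists>p\<in>carrier P. ev g p = \<zero> \<and> ev id_twist p \<noteq> \<zero>"
  shows "\<exists>q\<in>carrier P. (\<forall>g\<in>T. ev g q = \<zero>) \<and> ev id_twist q \<noteq> \<zero>"
  using assms
proof (induction T)
  case empty
  then show ?case using ev_one[OF id_twist] PR.P.one_closed by (metis empty_iff one_not_zero)
next
  case (insert h T)
  obtain q where q: "q \<in> carrier P" "\<forall>g\<in>T. ev g q = \<zero>" "ev id_twist q \<noteq> \<zero>"
    using insert by auto
  obtain p where p: "p \<in> carrier P" "ev h p = \<zero>" "ev id_twist p \<noteq> \<zero>"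
    using insert.prems(2)[of h] by auto
  have T: "g \<in> twists" if "g \<in> insert h T" for g using insert.prems(1) that by auto
  have "ev g (p \<otimes>\<^bsub>P\<^esub> q) = \<zero>" if g: "g \<in> insert h T" for g
    using ev_mult[OF T[OF g] p(1) q(1)] ev_carrier[OF T[OF g] p(1)] ev_carrier[OF T[OF g] q(1)] p(2) q(2) g
    by auto
  moreover have "ev id_twist (p \<otimes>\<^bsub>P\<^esub> q) \<noteq> \<zero>"
    using ev_mult[OF id_twist p(1) q(1)] p(3) q(3) ev_carrier[OF id_twist] p(1) q(1)
    by (simp add: integral_iff)
  ultimately show ?case using p(1) q(1) PR.P.m_closed by blast
qed

text \<open>
  Split the twists into \<open>S\<close>, those that induce automorphisms, and the rest. Choose a polynomial
  \<open>y\<close> that evaluates to \<open>x\<close> at the identity and to \<open>0\<close> at all twists outside \<open>S\<close>. As \<open>x\<close> is fixed, \<open>y\<close>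
  evaluates to \<open>x\<close> at each twist in \<open>S\<close>, so that the sum over all twists is \<open>|S| x\<close>. This sum
  lies in \<open>k\<close>, and \<open>|S|\<close> is invertible.
\<close>

lemma fixed_in_base:
  assumes x: "x \<in> K'" and fixed: "\<And>\<alpha>. \<alpha> \<in> Gal \<Omega> K' k \<Longrightarrow> \<alpha> x = x"
  shows "x \<in> k"
proof -
  define S where "S = {g \<in> twists. \<forall>p\<in>carrier P. ev g p = \<zero> \<longrightarrow> ev id_twist p = \<zero>}"
  have xc: "x \<in> carrier \<Omega>" using x E.K_carrier by simp
  have S: "finite S" "id_twist \<in> S" "S \<subseteq> twists"
    using finite_twists id_twist by (auto simp: S_def)
  obtain q where q: "q \<in> carrier P" "\<forall>g\<in>twists - S. ev g q = \<zero>" "ev id_twist q \<noteq> \<zero>"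
    using separating_poly[of "twists - S"] finite_twists unfolding S_def by auto
  have qK: "ev id_twist q \<in> K'" "ev id_twist q \<in> Units \<Omega>"
    using ev_in_K'[OF id_twist q(1)] q(3) field_Units ev_carrier[OF id_twist q(1)] by auto
  have "inv (ev id_twist q) \<otimes> x \<in> K'"
    using E.K_inv[OF qK(1) q(3)] x E.K_closed(6) by simp
  then obtain p where p: "p \<in> carrier P" "ev id_twist p = inv (ev id_twist q) \<otimes> x"
    using ev_surj[OF id_twist] by blast
  define y where "y = q \<otimes>\<^bsub>P\<^esub> p"
  have y: "y \<in> carrier P" using p q by (simp add: y_def)
  have y1: "ev id_twist y = x"
    unfolding y_def ev_mult[OF id_twist q(1) p(1)] p(2) using qK(2) xc Units_closed
    by (simp add: m_assoc[symmetric])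
  have y0: "ev g y = \<zero>" if g: "g \<in> twists - S" for g
    unfolding y_def using ev_mult[of g, OF _ q(1) p(1)] q(2) g ev_carrier[of g, OF _ p(1)] by auto
  have yS: "ev g y = x" if "g \<in> S" for g
  proof -
    have g: "g \<in> twists" "\<And>p. p \<in> carrier P \<Longrightarrow> ev g p = \<zero> \<Longrightarrow> ev id_twist p = \<zero>"
      using that by (auto simp: S_def)
    obtain \<alpha> where a: "\<alpha> \<in> Gal \<Omega> K' k" "\<forall>p\<in>carrier P. \<alpha> (ev g p) = ev id_twist p"
      using twist_induces_automorphism[OF g] by blast
    have "\<alpha> (ev g y) = \<alpha> x" using a(2) y y1 fixed[OF a(1)] by simp
    then show ?thesis
      using E.gal_bij[OF a(1)] ev_in_K'[OF g(1) y] x by (auto simp: bij_betw_def inj_on_def)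
  qed
  have "(\<Oplus>g\<in>twists. ev g y) = (\<Oplus>g\<in>S. x)"
    using S(3) finite_twists y0 yS xc ev_carrier[OF _ y]
    by (intro add.finprod_mono_neutral_cong_right) auto
  also have "\<dots> = [card S] \<cdot> x" using xc by (rule add.finprod_const)
  also have "\<dots> = [card S] \<cdot> \<one> \<otimes> x" using add_pow_ldistr[of \<one> x "card S"] xc by simp
  finally have mem: "[card S] \<cdot> \<one> \<otimes> x \<in> k" using ev_trace_in_base[OF y] by simp
  have "[N] \<cdot> \<one> \<in> k" for N :: nat
    by (induction N) (auto simp: k_closed)
  moreover have "card S > 0" using S card_gt_0_iff by blast
  hence "[card S] \<cdot> \<one> \<noteq> \<zero>" by (rule char_0)
  ultimately show ?thesis
    using subfield_m_inv_simprule[OF subfield_k, of "[card S] \<cdot> \<one>" x] mem xc by simp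
qed

lemma galois_K': "finite_galois \<Omega> K' k"
  unfolding finite_galois_def
proof (intro conjI subfield_k subfield_K' finite_dimension_K')
  show "k \<subseteq> K'" using k_subset_K K_subset_K' by (rule subset_trans)
  show "{x \<in> K'. \<forall>\<sigma>\<in>Gal \<Omega> K' k. \<sigma> x = x} = k"
  proof
    show "{x \<in> K'. \<forall>\<sigma>\<in>Gal \<Omega> K' k. \<sigma> x = x} \<subseteq> k" using fixed_in_base by blast
    show "k \<subseteq> {x \<in> K'. \<forall>\<sigma>\<in>Gal \<Omega> K' k. \<sigma> x = x}"
      using E.gal_fix k_subset_K K_subset_K' by blast
  qed
qed

lemma generate_field_eq: "generate_field \<Omega> (insert w K) = K'"
proof
  have c: "insert w K \<subseteq> carrier \<Omega>" using w K_closed(1) by simp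
  show "generate_field \<Omega> (insert w K) \<subseteq> K'"
    using generate_field_min_subfield1[OF c subfield_K'] K_subset_K' w_in_K' by simp
  show "K' \<subseteq> generate_field \<Omega> (insert w K)"
    using generate_field_is_subfield[OF c] generate_field.incl[of _ "insert w K" \<Omega>]
    by (intro K'_subset) auto
qed

end

section \<open>Second cohomology with constant coefficients\<close>

lemma coboundary_mem_iff:
  "c \<in> coboundaries2 G A \<longleftrightarrow> (\<exists>b \<in> carrier G \<rightarrow> carrier A. c =
     (\<lambda>(\<sigma>, \<tau>) \<in> carrier G \<times> carrier G. b \<sigma> \<otimes>\<^bsub>A\<^esub> b \<tau> \<otimes>\<^bsub>A\<^esub> inv\<^bsub>A\<^esub> b (\<sigma> \<otimes>\<^bsub>G\<^esub> \<tau>)))"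
  unfolding coboundaries2_def by blast

lemma cocycles2_mult: "x \<otimes>\<^bsub>cocycles2 G A\<^esub> y = (\<lambda>i\<in>carrier G \<times> carrier G. x i \<otimes>\<^bsub>A\<^esub> y i)"
  by (simp add: cocycles2_def Let_def)

lemma H2_class_eq_one_iff:
  assumes "comm_group A" "group G"
    and c: "c \<in> carrier G \<times> carrier G \<rightarrow>\<^sub>E carrier A"
  shows "H2_class G A c = \<one>\<^bsub>H2 G A\<^esub> \<longleftrightarrow> c \<in> coboundaries2 G A"
proof -
  interpret A: comm_group A by fact
  interpret G: group G by fact
  let ?I = "carrier G \<times> carrier G"
  let ?B = "coboundaries2 G A"
  define \<delta> where "\<delta> b = (\<lambda>(\<sigma>, \<tau>) \<in> ?I. b \<sigma> \<otimes>\<^bsub>A\<^esub> b \<tau> \<otimes>\<^bsub>A\<^esub> inv\<^bsub>A\<^esub> b (\<sigma> \<otimes>\<^bsub>G\<^esub> \<tau>))" for b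
  have B: "x \<in> ?B \<longleftrightarrow> (\<exists>b \<in> carrier G \<rightarrow> carrier A. x = \<delta> b)" for x
    unfolding coboundary_mem_iff \<delta>_def ..
  have mult: "\<delta> a \<otimes>\<^bsub>cocycles2 G A\<^esub> \<delta> b = \<delta> (\<lambda>x. a x \<otimes>\<^bsub>A\<^esub> b x)"
    if ab: "a \<in> carrier G \<rightarrow> carrier A" "b \<in> carrier G \<rightarrow> carrier A" for a b
  proof
    fix i
    show "(\<delta> a \<otimes>\<^bsub>cocycles2 G A\<^esub> \<delta> b) i = \<delta> (\<lambda>x. a x \<otimes>\<^bsub>A\<^esub> b x) i"
    proof (cases "i \<in> ?I")
      case True
      then obtain x y where i: "i = (x, y)" "x \<in> carrier G" "y \<in> carrier G" by auto
      have "a z \<in> carrier A" "b z \<in> carrier A" if "z \<in> carrier G" for z using ab that by auto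
      then show ?thesis using i
        by (simp add: cocycles2_mult \<delta>_def A.inv_mult A.m_ac)
    next
      case False
      then show ?thesis by (simp add: cocycles2_mult \<delta>_def restrict_def)
    qed
  qed
  have one: "\<one>\<^bsub>H2 G A\<^esub> = ?B" by (simp add: H2_def FactGroup_def)
  have cls: "H2_class G A c = (\<lambda>x. x \<otimes>\<^bsub>cocycles2 G A\<^esub> c) ` ?B"
    by (auto simp: H2_class_def r_coset_def)
  show ?thesis
  proof
    assume "H2_class G A c = \<one>\<^bsub>H2 G A\<^esub>"
    moreover have "\<delta> (\<lambda>_. \<one>\<^bsub>A\<^esub>) \<in> ?B" unfolding B by blast
    ultimately have "\<delta> (\<lambda>_. \<one>\<^bsub>A\<^esub>) \<otimes>\<^bsub>cocycles2 G A\<^esub> c \<in> ?B" using one cls by blast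
    moreover have "\<delta> (\<lambda>_. \<one>\<^bsub>A\<^esub>) \<otimes>\<^bsub>cocycles2 G A\<^esub> c = c"
    proof
      fix i
      show "(\<delta> (\<lambda>_. \<one>\<^bsub>A\<^esub>) \<otimes>\<^bsub>cocycles2 G A\<^esub> c) i = c i"
        using c by (cases i) (auto simp: cocycles2_mult \<delta>_def PiE_iff extensional_def)
    qed
    ultimately show "c \<in> ?B" by simp
  next
    assume "c \<in> ?B"
    then obtain b where b: "b \<in> carrier G \<rightarrow> carrier A" "c = \<delta> b" unfolding B by blast
    have "(\<lambda>x. x \<otimes>\<^bsub>cocycles2 G A\<^esub> c) ` ?B = ?B"
    proof
      show "(\<lambda>x. x \<otimes>\<^bsub>cocycles2 G A\<^esub> c) ` ?B \<subseteq> ?B"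
      proof
        fix y assume "y \<in> (\<lambda>x. x \<otimes>\<^bsub>cocycles2 G A\<^esub> c) ` ?B"
        then obtain a where a: "a \<in> carrier G \<rightarrow> carrier A" "y = \<delta> a \<otimes>\<^bsub>cocycles2 G A\<^esub> c"
          unfolding B by (auto simp: B)
        have "y = \<delta> (\<lambda>x. a x \<otimes>\<^bsub>A\<^esub> b x)" using a b mult by simp
        moreover have "(\<lambda>x. a x \<otimes>\<^bsub>A\<^esub> b x) \<in> carrier G \<rightarrow> carrier A" using a b by auto
        ultimately show "y \<in> ?B" unfolding B by blast
      qed
      show "?B \<subseteq> (\<lambda>x. x \<otimes>\<^bsub>cocycles2 G A\<^esub> c) ` ?B"
      proof
        fix y assume "y \<in> ?B"
        then obtain a where a: "a \<in> carrier G \<rightarrow> carrier A" "y = \<delta> a" unfolding B by blast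
        let ?q = "\<lambda>x. a x \<otimes>\<^bsub>A\<^esub> inv\<^bsub>A\<^esub> b x"
        have q: "?q \<in> carrier G \<rightarrow> carrier A" using a b by auto
        have "\<delta> ?q \<otimes>\<^bsub>cocycles2 G A\<^esub> c = \<delta> (\<lambda>x. ?q x \<otimes>\<^bsub>A\<^esub> b x)" using q b mult by simp
        also have "\<dots> = \<delta> a"
        proof -
          have "?q x \<otimes>\<^bsub>A\<^esub> b x = a x" if "x \<in> carrier G" for x
          proof -
            have "a x \<in> carrier A" "b x \<in> carrier A" using a b that by auto
            then show ?thesis by (simp add: A.m_assoc)
          qed
          then show ?thesis by (auto simp: \<delta>_def restrict_def fun_eq_iff)
        qed
        finally have "y = \<delta> ?q \<otimes>\<^bsub>cocycles2 G A\<^esub> c" using a(2) by simp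
        moreover have "\<delta> ?q \<in> ?B" unfolding B using q by (intro bexI[of _ ?q]) auto
        ultimately show "y \<in> (\<lambda>x. x \<otimes>\<^bsub>cocycles2 G A\<^esub> c) ` ?B" by (rule image_eqI)
      qed
    qed
    then show "H2_class G A c = \<one>\<^bsub>H2 G A\<^esub>" using one cls by simp
  qed
qed

lemma cocycles2_pow:
  "c [^]\<^bsub>cocycles2 G A\<^esub> (s::nat) = (\<lambda>i\<in>carrier G \<times> carrier G. c i [^]\<^bsub>A\<^esub> s)"
proof (induction s)
  case 0
  then show ?case by (simp add: cocycles2_def Let_def)
next
  case (Suc s)
  then show ?case by (auto simp: cocycles2_mult restrict_def fun_eq_iff)
qed

context field
begin

lemma units_group_simps:
  "carrier (units_group R C) = C - {\<zero>}"
  "x \<otimes>\<^bsub>units_group R C\<^esub> y = x \<otimes> y"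
  "\<one>\<^bsub>units_group R C\<^esub> = \<one>"
  "x [^]\<^bsub>units_group R C\<^esub> (n::nat) = x [^] n"
  by (simp_all add: Ring_Divisibility.mult_of_def nat_pow_def)

lemma
  assumes C: "subfield C R"
  shows comm_group_units_group: "comm_group (units_group R C)"
    and units_group_inv: "x \<in> C - {\<zero>} \<Longrightarrow> inv\<^bsub>units_group R C\<^esub> x = inv x"
proof -
  note Cc = subringE[OF subfieldE(1)[OF C]]
  have c: "x \<in> carrier R" if "x \<in> C" for x using Cc(1) that by auto
  note i = subfield_m_inv[OF C]
  show G: "comm_group (units_group R C)"
  proof (rule comm_groupI)
    fix x assume "x \<in> carrier (units_group R C)"
    then show "\<exists>y\<in>carrier (units_group R C). y \<otimes>\<^bsub>units_group R C\<^esub> x = \<one>\<^bsub>units_group R C\<^esub>"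
      using i[of x] by (auto simp: units_group_simps)
  qed (use Cc c in \<open>auto simp: units_group_simps integral_iff m_ac\<close>)
  show "inv\<^bsub>units_group R C\<^esub> x = inv x" if "x \<in> C - {\<zero>}"
    by (rule group.inv_equality[OF comm_group.axioms(2)[OF G]]) (use i[OF that] that in \<open>auto simp: units_group_simps\<close>)
qed

lemma finprod_in_subfield_units:
  assumes C: "subfield C R" and "h \<in> A \<rightarrow> C - {\<zero>}"
  shows "(\<Otimes>a\<in>A. h a) \<in> C - {\<zero>}"
  using assms(2)
proof (induction A rule: infinite_finite_induct)
  case (insert x A)
  note Cc = subringE[OF subfieldE(1)[OF C]]
  have "(\<Otimes>a\<in>insert x A. h a) = h x \<otimes> (\<Otimes>a\<in>A. h a)"
    using insert Cc(1) by (intro finprod_insert) auto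
  moreover have "h x \<in> C - {\<zero>}" "(\<Otimes>a\<in>A. h a) \<in> C - {\<zero>}" using insert by auto
  moreover from this have "h x \<in> carrier R" "(\<Otimes>a\<in>A. h a) \<in> carrier R" using Cc(1) by auto
  ultimately show ?case using Cc(6) by (simp add: integral_iff)
qed (auto simp: subringE(3)[OF subfieldE(1)[OF C]])

lemma twisted_ratio_eq:
  assumes "F \<in> Units R" "y \<in> Units R" "u \<in> carrier R" "e \<in> Units R" "p \<in> carrier R"
    and u: "u \<otimes> inv e = y \<otimes> inv F" and y: "y = p \<otimes> (F \<otimes> u)"
  shows "p = inv e"
proof -
  have c: "F \<in> carrier R" "y \<in> carrier R" "e \<in> carrier R" "inv F \<in> carrier R" "inv e \<in> carrier R"
    using assms by auto
  have "(p \<otimes> F) \<otimes> (u \<otimes> inv e) = (p \<otimes> (F \<otimes> u)) \<otimes> inv e"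
    using c assms(3,5) by (simp add: m_assoc)
  also have "\<dots> = y \<otimes> inv e" by (rule arg_cong[OF y[symmetric]])
  finally have "(p \<otimes> F) \<otimes> (u \<otimes> inv e) = y \<otimes> inv e" .
  hence "((p \<otimes> F) \<otimes> inv F) \<otimes> y = inv e \<otimes> y"
    unfolding u using c assms(5) by (simp add: m_ac)
  hence "p \<otimes> y = inv e \<otimes> y" using c assms(1,5) by (simp add: m_assoc)
  moreover have "y \<noteq> \<zero>" using assms(2) field_Units by auto
  ultimately show ?thesis using m_rcancel[of y p "inv e"] c assms(5) by simp
qed

lemma coboundary_value:
  assumes "x \<in> carrier R" "y \<in> carrier R" "v \<in> Units R" "a \<in> carrier R"
    and "w \<in> Units R" "f \<in> Units R" "t \<in> Units R"
    and eq: "x \<otimes> (y \<otimes> (w \<otimes> (f \<otimes> t))) = v \<otimes> (w \<otimes> (a \<otimes> f \<otimes> t))"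
  shows "a = x \<otimes> y \<otimes> inv v"
proof -
  let ?z = "w \<otimes> (f \<otimes> t)"
  have c: "v \<in> carrier R" "w \<in> carrier R" "f \<in> carrier R" "t \<in> carrier R" "inv v \<in> carrier R"
    using assms by auto
  have z: "?z \<in> carrier R" "?z \<noteq> \<zero>" using assms c field_Units by (auto simp: integral_iff)
  have "(x \<otimes> y) \<otimes> ?z = (v \<otimes> a) \<otimes> ?z" using eq c assms(1,2,4) by (simp add: m_ac)
  hence "x \<otimes> y = v \<otimes> a" using m_rcancel[OF z(2) z(1), of "x \<otimes> y" "v \<otimes> a"] c assms(1,2,4) by simp
  hence "x \<otimes> y \<otimes> inv v = (v \<otimes> inv v) \<otimes> a" using c assms(4) by (simp add: m_ac)
  then show ?thesis using assms(3,4) by simp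
qed

lemma power_in_alg_closed:
  assumes "subfield C R" "algebraically_closed (R\<lparr>carrier := C\<rparr>)"
    and "x \<in> carrier R" "x [^] (n::nat) \<in> C" "0 < n"
  shows "x \<in> C"
  using algebraically_closed_contains_algebraic[OF assms(1-3)]
    algebraic_if_power_in[OF assms(1,3-5)] by blast

end

section \<open>Descent fields\<close>

text \<open>
  This covers both parts of the theorem. For \<open>g\<close> in \<open>Gal(K(w)/k)\<close> with restriction \<open>\<phi>\<close> to \<open>K\<close>
  put \<open>b(g) = g(w) / (w f\<^sub>\<phi>)\<close>. Its \<open>n\<close>-th power is \<open>\<phi>(F) / (F f\<^sub>\<phi>\<^sup>n) = 1 / d(\<phi>)\<close>, hence it is a
  constant, and the relation between \<open>f\<close> and \<open>c\<close> becomes \<open>b(g) b(h) = c(g, h) b(gh)\<close>: the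
  pulled-back cocycle is the coboundary of \<open>b\<close>.
\<close>

lemma (in galois_extension) descent_field_of_root:
  assumes C: "subfield C \<Omega>" "C \<subseteq> k" "algebraically_closed (sub_ring_of \<Omega> C)"
      "char_zero (sub_ring_of \<Omega> C)"
    and c: "\<And>\<phi> \<tau>. \<phi> \<in> \<Gamma> \<Longrightarrow> \<tau> \<in> \<Gamma> \<Longrightarrow> c (\<phi>, \<tau>) \<in> C - {\<zero>}"
    and f: "\<And>\<phi>. \<phi> \<in> \<Gamma> \<Longrightarrow> f \<phi> \<in> K - {\<zero>}"
    and cf: "\<And>\<phi> \<tau>. \<phi> \<in> \<Gamma> \<Longrightarrow> \<tau> \<in> \<Gamma> \<Longrightarrow>
      f (\<phi> \<otimes>\<^bsub>GalGroup \<Omega> K k\<^esub> \<tau>) = c (\<phi>, \<tau>) \<otimes> f \<phi> \<otimes> \<phi> (f \<tau>)"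
    and n: "0 < (n::nat)"
    and d: "\<And>\<phi>. \<phi> \<in> \<Gamma> \<Longrightarrow> d \<phi> \<in> C - {\<zero>}"
    and F: "F \<in> K - {\<zero>}"
    and dF: "\<And>\<phi>. \<phi> \<in> \<Gamma> \<Longrightarrow> f \<phi> [^] n \<otimes> inv d \<phi> = \<phi> F \<otimes> inv F"
    and w: "w \<in> carrier \<Omega>" "w [^] n = F"
  shows "descent_field \<Omega> C k K c (generate_field \<Omega> (insert w K))"
proof -
  interpret L: algebraically_closed "sub_ring_of \<Omega> C" by fact
  have Cc: "x \<in> k" "x \<in> K" "x \<in> carrier \<Omega>" if "x \<in> C" for x
    using that C(2) k_subset_K K_carrier by auto
  have subpow: "x [^]\<^bsub>sub_ring_of \<Omega> C\<^esub> (j::nat) = x [^] j" for x j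
    by (simp add: nat_pow_def)
  have FK: "F \<in> K" "F \<noteq> \<zero>" "F \<in> Units \<Omega>" "F \<in> carrier \<Omega>"
    using F K_carrier field_Units by auto
  have fK: "f \<phi> \<in> K" "f \<phi> \<noteq> \<zero>" "f \<phi> \<in> Units \<Omega>" "f \<phi> \<in> carrier \<Omega>" if "\<phi> \<in> \<Gamma>" for \<phi>
    using f[OF that] K_carrier field_Units by auto
  have dC: "d \<phi> \<in> Units \<Omega>" "inv d \<phi> \<in> C" "inv d \<phi> \<in> carrier \<Omega>" if "\<phi> \<in> \<Gamma>" for \<phi>
    using d[OF that] subfield_m_inv(1)[OF C(1) d[OF that]] Cc field_Units by auto
  interpret kummer_extension \<Omega> K k n F w
  proof (unfold_locales)
    fix \<phi> assume phi: "\<phi> \<in> \<Gamma>"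
    obtain e where e: "e \<in> C" "e [^] n = inv d \<phi>"
      using L.exists_nth_root[of "inv d \<phi>" n] dC[OF phi] n by (auto simp: subpow)
    \<comment> \<open>So \<open>f \<phi> \<otimes> e\<close> is an \<open>n\<close>-th root of \<open>\<phi> F \<otimes> inv F\<close> in \<open>K\<close>.\<close>
    have "(f \<phi> \<otimes> e) [^] n \<otimes> F = (f \<phi> [^] n \<otimes> inv d \<phi>) \<otimes> F"
      using e fK[OF phi] Cc by (simp add: nat_pow_distrib)
    also have "\<dots> = \<phi> F"
      using dF[OF phi] FK gal_closed[OF phi FK(1)] K_carrier by (simp add: m_assoc)
    finally show "\<exists>u\<in>K. u [^] n \<otimes> F = \<phi> F"
      using fK[OF phi] Cc e K_closed(6) by blast
  next
    fix i :: nat assume "\<not> n dvd i"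
    then obtain \<zeta> where "\<zeta> \<in> C" "\<zeta> [^] n = \<one>" "\<zeta> [^] i \<noteq> \<one>"
      using L.root_of_unity_separates[OF C(4) n] by (auto simp: subpow)
    then show "\<exists>\<zeta>\<in>K. \<zeta> [^] n = \<one> \<and> \<zeta> [^] i \<noteq> \<one>" using Cc(2) by blast
  next
    fix N :: nat assume "0 < N"
    moreover have "[N] \<cdot>\<^bsub>sub_ring_of \<Omega> C\<^esub> \<one> = [N] \<cdot> \<one>" by (simp add: add_pow_def nat_pow_def)
    ultimately show "[N] \<cdot> \<one> \<noteq> \<zero>" using C(4) unfolding char_zero_def by auto
  qed (use n F w in auto)
  let ?\<Delta> = "Gal \<Omega> K' k"
  have w0: "w \<noteq> \<zero>" using w FK n by (auto simp: nat_pow_zero)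
  have res: "restrict g K \<in> \<Gamma>" if g: "g \<in> ?\<Delta>" for g
  proof (rule embedding_restrict_in_gal)
    show "g \<in> ring_hom (sub_ring_of \<Omega> K) \<Omega>"
    proof (rule ring_hom_memI)
      show "g x \<in> carrier \<Omega>" if "x \<in> carrier (sub_ring_of \<Omega> K)" for x
        using E.K_carrier[OF E.gal_closed[OF g subsetD[OF K_subset_K']]] that by simp
      fix x y assume "x \<in> carrier (sub_ring_of \<Omega> K)" "y \<in> carrier (sub_ring_of \<Omega> K)"
      hence xy: "x \<in> K'" "y \<in> K'" using subsetD[OF K_subset_K'] by simp_all
      show "g (x \<otimes>\<^bsub>sub_ring_of \<Omega> K\<^esub> y) = g x \<otimes> g y" using E.gal_mult[OF g xy] by simp
      show "g (x \<oplus>\<^bsub>sub_ring_of \<Omega> K\<^esub> y) = g x \<oplus> g y" using E.gal_add[OF g xy] by simp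
    qed (use E.gal_one[OF g] in simp)
    show "g x = x" if "x \<in> k" for x by (rule E.gal_fix[OF g that])
  qed
  have wf: "w \<otimes> f (restrict g K) \<in> Units \<Omega>" "g w \<in> carrier \<Omega>" "g w \<noteq> \<zero>" if g: "g \<in> ?\<Delta>" for g
  proof -
    have "w \<in> Units \<Omega>" using w(1) w0 field_Units by simp
    then show "w \<otimes> f (restrict g K) \<in> Units \<Omega>" using fK(3)[OF res[OF g]] by simp
    show "g w \<in> carrier \<Omega>" by (rule E.K_carrier[OF E.gal_closed[OF g w_in_K']])
    show "g w \<noteq> \<zero>" using E.gal_eq_zero[OF g w_in_K'] w0 by simp
  qed
  define b where "b g = g w \<otimes> inv (w \<otimes> f (restrict g K))" for g
  have bc: "b g \<in> carrier \<Omega>" if "g \<in> ?\<Delta>" for g using wf[OF that] by (simp add: b_def)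
  have gw: "g w = b g \<otimes> (w \<otimes> f (restrict g K))" if "g \<in> ?\<Delta>" for g
    using wf[OF that] Units_closed by (simp add: b_def m_assoc)
  have bC: "b g \<in> C - {\<zero>}" if g: "g \<in> ?\<Delta>" for g
  proof -
    let ?\<phi> = "restrict g K"
    note r = res[OF g]
    have c: "?\<phi> F \<in> carrier \<Omega>" "d ?\<phi> \<in> carrier \<Omega>"
      using gal_closed[OF r FK(1)] K_carrier d[OF r] Cc by auto
    have "g F = g w [^] n" using E.gal_pow[OF g w_in_K', of n] w(2) by simp
    also have "g w = b g \<otimes> (w \<otimes> f ?\<phi>)" by (rule gw[OF g])
    also have "\<dots> [^] n = b g [^] n \<otimes> (w \<otimes> f ?\<phi>) [^] n"
      by (rule nat_pow_distrib[OF bc[OF g] Units_closed[OF wf(1)[OF g]]])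
    also have "(w \<otimes> f ?\<phi>) [^] n = F \<otimes> f ?\<phi> [^] n"
      unfolding nat_pow_distrib[OF w(1) fK(4)[OF r]] w(2) ..
    also have "g F = ?\<phi> F" using FK(1) by simp
    finally have yF: "?\<phi> F = b g [^] n \<otimes> (F \<otimes> f ?\<phi> [^] n)" .
    have "?\<phi> F \<in> Units \<Omega>" using c(1) gal_eq_zero[OF r FK(1)] FK(2) field_Units by simp
    from twisted_ratio_eq[OF FK(3) this nat_pow_closed[OF fK(4)[OF r]] dC(1)[OF r]
        nat_pow_closed[OF bc[OF g]] dF[OF r] yF]
    have "b g [^] n = inv d ?\<phi>" .
    hence "b g [^] n \<in> C" using dC(2)[OF r] by simp
    hence "b g \<in> C" using power_in_alg_closed[OF C(1,3) bc[OF g] _ n] by simp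
    moreover have "b g \<noteq> \<zero>"
    proof
      assume "b g = \<zero>"
      hence "g w = \<zero>" using gw[OF g] l_null[OF Units_closed[OF wf(1)[OF g]]] by simp
      with wf(3)[OF g] show False ..
    qed
    ultimately show ?thesis by simp
  qed
  have cob: "c (restrict g K, restrict h K) = b g \<otimes> b h \<otimes> inv b (g \<otimes>\<^bsub>GalGroup \<Omega> K' k\<^esub> h)"
    if g: "g \<in> ?\<Delta>" and h: "h \<in> ?\<Delta>" for g h
  proof -
    let ?gh = "g \<otimes>\<^bsub>GalGroup \<Omega> K' k\<^esub> h" and ?\<phi> = "restrict g K" and ?\<tau> = "restrict h K"
    note gh = E.gal_comp_mem[OF g h]
    note r = res[OF g] res[OF h]
    have rgh: "restrict ?gh K = ?\<phi> \<otimes>\<^bsub>GalGroup \<Omega> K k\<^esub> ?\<tau>"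
      unfolding GalGroup_mult[OF r] E.GalGroup_mult[OF g h]
      using gal_closed[OF r(2)] K_subset_K' by (auto simp: compose_def restrict_def fun_eq_iff)
    have ft: "f ?\<tau> \<in> K'" by (rule subsetD[OF K_subset_K' fK(1)[OF r(2)]])
    have gft: "g (f ?\<tau>) = ?\<phi> (f ?\<tau>)" by (rule restrict_apply'[OF fK(1)[OF r(2)], symmetric])
    have pft: "?\<phi> (f ?\<tau>) \<in> carrier \<Omega>" "?\<phi> (f ?\<tau>) \<in> Units \<Omega>"
      using K_carrier[OF gal_closed[OF r(1) fK(1)[OF r(2)]]]
        gal_eq_zero[OF r(1) fK(1)[OF r(2)]] fK(2)[OF r(2)] field_Units by auto
    have bu: "b ?gh \<in> Units \<Omega>" using bC[OF gh] bc[OF gh] field_Units by simp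
    have bh: "b h \<in> K'" "g (b h) = b h"
    proof -
      have "b h \<in> C" using bC[OF h] by simp
      then show "b h \<in> K'" "g (b h) = b h"
        using subsetD[OF K_subset_K' Cc(2)] E.gal_fix[OF g Cc(1)] by simp_all
    qed
    have cc: "c (?\<phi>, ?\<tau>) \<in> carrier \<Omega>" using c[OF r] Cc(3) by simp
    have wu: "w \<in> Units \<Omega>" using w(1) w0 field_Units by simp
    \<comment> \<open>Two expressions for the value of the product at \<open>w\<close>.\<close>
    have "?gh w = g (h w)" by (rule E.gal_comp_apply[OF g h w_in_K'])
    also have "\<dots> = g (b h \<otimes> (w \<otimes> f ?\<tau>))" by (subst gw[OF h]) (rule refl)
    also have "\<dots> = b h \<otimes> (g w \<otimes> ?\<phi> (f ?\<tau>))"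
      unfolding E.gal_mult[OF g bh(1) E.K_closed(6)[OF w_in_K' ft]] E.gal_mult[OF g w_in_K' ft]
        bh(2) gft ..
    also have "\<dots> = b h \<otimes> ((b g \<otimes> (w \<otimes> f ?\<phi>)) \<otimes> ?\<phi> (f ?\<tau>))" by (subst gw[OF g]) (rule refl)
    also have "\<dots> = b g \<otimes> (b h \<otimes> (w \<otimes> (f ?\<phi> \<otimes> ?\<phi> (f ?\<tau>))))"
    proof -
      have "y \<otimes> ((x \<otimes> (w \<otimes> u)) \<otimes> t) = x \<otimes> (y \<otimes> (w \<otimes> (u \<otimes> t)))"
        if "x \<in> carrier \<Omega>" "y \<in> carrier \<Omega>" "u \<in> carrier \<Omega>" "t \<in> carrier \<Omega>" for x y u t
        using that w(1) by (simp only: m_ac m_closed)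
      then show ?thesis using bc[OF g] bc[OF h] fK(4)[OF r(1)] pft(1) by blast
    qed
    finally have "b g \<otimes> (b h \<otimes> (w \<otimes> (f ?\<phi> \<otimes> ?\<phi> (f ?\<tau>))))
        = b ?gh \<otimes> (w \<otimes> (c (?\<phi>, ?\<tau>) \<otimes> f ?\<phi> \<otimes> ?\<phi> (f ?\<tau>)))"
      unfolding gw[OF gh] rgh cf[OF r] ..
    then show ?thesis
      by (rule coboundary_value[OF bc[OF g] bc[OF h] bu cc wu fK(3)[OF r(1)] pft(2)])
  qed
  have ind: "induced_cocycle \<Omega> K' K k c \<in> coboundaries2 (GalGroup \<Omega> K' k) (units_group \<Omega> C)"
    unfolding coboundary_mem_iff
  proof (intro bexI)
    show "b \<in> carrier (GalGroup \<Omega> K' k) \<rightarrow> carrier (units_group \<Omega> C)"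
      using bC by (auto simp: units_group_simps)
    have "inv\<^bsub>units_group \<Omega> C\<^esub> b (g \<otimes>\<^bsub>GalGroup \<Omega> K' k\<^esub> h) = inv b (g \<otimes>\<^bsub>GalGroup \<Omega> K' k\<^esub> h)"
      if "g \<in> ?\<Delta>" "h \<in> ?\<Delta>" for g h
      by (rule units_group_inv[OF C(1) bC[OF E.gal_comp_mem[OF that]]])
    then show "induced_cocycle \<Omega> K' K k c =
      (\<lambda>(\<sigma>, \<tau>) \<in> carrier (GalGroup \<Omega> K' k) \<times> carrier (GalGroup \<Omega> K' k).
        b \<sigma> \<otimes>\<^bsub>units_group \<Omega> C\<^esub> b \<tau> \<otimes>\<^bsub>units_group \<Omega> C\<^esub>
        inv\<^bsub>units_group \<Omega> C\<^esub> b (\<sigma> \<otimes>\<^bsub>GalGroup \<Omega> K' k\<^esub> \<tau>))"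
      using cob by (auto simp: induced_cocycle_def units_group_simps restrict_def fun_eq_iff)
  qed
  have "induced_cocycle \<Omega> K' K k c \<in> carrier (GalGroup \<Omega> K' k) \<times> carrier (GalGroup \<Omega> K' k)
      \<rightarrow>\<^sub>E carrier (units_group \<Omega> C)"
    using c res by (auto simp: induced_cocycle_def units_group_simps)
  hence "H2_class (GalGroup \<Omega> K' k) (units_group \<Omega> C) (induced_cocycle \<Omega> K' K k c)
      = \<one>\<^bsub>H2 (GalGroup \<Omega> K' k) (units_group \<Omega> C)\<^esub>"
    using H2_class_eq_one_iff[OF comm_group_units_group[OF C(1)] E.group_GalGroup] ind by blast
  then show ?thesis
    unfolding descent_field_def generate_field_eq using galois_K' K_subset_K' by blast
qed

lemma (in comm_monoid) Units_inv_mult: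
  assumes "x \<in> Units G" "y \<in> Units G"
  shows "inv (x \<otimes> y) = inv x \<otimes> inv y"
proof (rule comm_inv_char)
  note c = Units_closed[OF assms(1)] Units_closed[OF assms(2)]
    Units_inv_closed[OF assms(1)] Units_inv_closed[OF assms(2)]
  have "(x \<otimes> y) \<otimes> (inv x \<otimes> inv y) = (x \<otimes> inv x) \<otimes> (y \<otimes> inv y)"
    using c by (simp only: m_ac m_closed)
  then show "(x \<otimes> y) \<otimes> (inv x \<otimes> inv y) = \<one>" using assms by simp
qed (use assms in auto)

lemma (in field) generate_field_insert_inv:
  assumes "K \<subseteq> carrier R" "w \<in> Units R"
  shows "generate_field R (insert (inv w) K) = generate_field R (insert w K)"
proof -
  have sub: "generate_field R (insert (inv v) K) \<subseteq> generate_field R (insert v K)" if "v \<in> Units R" for v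
  proof (rule generate_field_min_subfield1)
    have v: "v \<in> carrier R" "inv v \<in> carrier R" "v \<noteq> \<zero>" using that field_Units by auto
    show "insert (inv v) K \<subseteq> carrier R" using v assms(1) by simp
    show "subfield (generate_field R (insert v K)) R"
      using v assms(1) by (intro generate_field_is_subfield) simp
    show "insert (inv v) K \<subseteq> generate_field R (insert v K)"
      using v by (auto intro: generate_field.intros)
  qed
  show ?thesis using sub[OF assms(2)] sub[of "inv w"] assms(2) by auto
qed

context galois_extension
begin

text \<open>
  Multiply the relation between \<open>f\<close> and \<open>c\<close> over all \<open>\<tau>\<close>. It shows that \<open>G\<^sup>-\<^sup>1\<close> can play the
  role of \<open>F\<close> for the exponent \<open>|Gal(K/k)|\<close>.
\<close>

lemma norm_of_cochain:
  assumes C: "subfield C \<Omega>"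
    and c: "\<And>\<tau>. \<tau> \<in> \<Gamma> \<Longrightarrow> c (\<phi>, \<tau>) \<in> C - {\<zero>}"
    and f: "\<And>\<phi>. \<phi> \<in> \<Gamma> \<Longrightarrow> f \<phi> \<in> K - {\<zero>}"
    and cf: "\<And>\<tau>. \<tau> \<in> \<Gamma> \<Longrightarrow>
      f (\<phi> \<otimes>\<^bsub>GalGroup \<Omega> K k\<^esub> \<tau>) = c (\<phi>, \<tau>) \<otimes> f \<phi> \<otimes> \<phi> (f \<tau>)"
    and phi: "\<phi> \<in> \<Gamma>"
  defines "G \<equiv> (\<Otimes>\<tau>\<in>\<Gamma>. f \<tau>)"
  shows "G = (\<Otimes>\<tau>\<in>\<Gamma>. c (\<phi>, \<tau>)) \<otimes> f \<phi> [^] card \<Gamma> \<otimes> \<phi> G"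
proof -
  have cc: "c (\<phi>, \<tau>) \<in> carrier \<Omega>" if "\<tau> \<in> \<Gamma>" for \<tau>
    using c[OF that] subringE(1)[OF subfieldE(1)[OF C]] by auto
  have fK: "f \<tau> \<in> K" "f \<tau> \<in> carrier \<Omega>" if "\<tau> \<in> \<Gamma>" for \<tau> using f[OF that] K_carrier by auto
  have pf: "\<phi> (f \<tau>) \<in> carrier \<Omega>" if "\<tau> \<in> \<Gamma>" for \<tau>
    by (rule K_carrier[OF gal_closed[OF phi fK(1)[OF that]]])
  have "G = (\<Otimes>\<tau>\<in>\<Gamma>. f (\<phi> \<otimes>\<^bsub>GalGroup \<Omega> K k\<^esub> \<tau>))"
    unfolding G_def using fK(2) by (intro gal_prod_translate[OF phi, symmetric]) simp
  also have "\<dots> = (\<Otimes>\<tau>\<in>\<Gamma>. c (\<phi>, \<tau>) \<otimes> f \<phi> \<otimes> \<phi> (f \<tau>))"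
    using cc fK(2)[OF phi] pf cf by (intro finprod_cong') auto
  also have "\<dots> = (\<Otimes>\<tau>\<in>\<Gamma>. c (\<phi>, \<tau>) \<otimes> f \<phi>) \<otimes> (\<Otimes>\<tau>\<in>\<Gamma>. \<phi> (f \<tau>))"
    using cc fK(2)[OF phi] pf by (intro finprod_multf) auto
  also have "(\<Otimes>\<tau>\<in>\<Gamma>. c (\<phi>, \<tau>) \<otimes> f \<phi>) = (\<Otimes>\<tau>\<in>\<Gamma>. c (\<phi>, \<tau>)) \<otimes> (\<Otimes>\<tau>\<in>\<Gamma>. f \<phi>)"
    using cc fK(2)[OF phi] by (intro finprod_multf) auto
  also have "(\<Otimes>\<tau>\<in>\<Gamma>. f \<phi>) = f \<phi> [^] card \<Gamma>" by (rule finprod_const[OF fK(2)[OF phi]])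
  also have "(\<Otimes>\<tau>\<in>\<Gamma>. \<phi> (f \<tau>)) = \<phi> G"
    unfolding G_def using gal_finprod[OF phi, of f \<Gamma>] fK(1) by auto
  finally show ?thesis .
qed

end

theorem mainTheorem2:
  fixes \<Omega> :: "('a, 'b) ring_scheme"
    and C k K :: "'a set" and z :: 'a and D :: "'a \<Rightarrow> 'a"
    and m s :: nat
    and c :: "('a \<Rightarrow> 'a) \<times> ('a \<Rightarrow> 'a) \<Rightarrow> 'a"
    and f :: "('a \<Rightarrow> 'a) \<Rightarrow> 'a"
  assumes "field \<Omega>"
    and "subfield C \<Omega>"
    and "algebraically_closed (sub_ring_of \<Omega> C)"
    and "char_zero (sub_ring_of \<Omega> C)"
    and "finite_ext_of_rational_functions \<Omega> C z k D"
    and "finite_galois \<Omega> K k"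
    and "ring.dimension \<Omega> m k K"
    and "1 \<le> s"
    and "c \<in> carrier (cocycles2 (GalGroup \<Omega> K k) (units_group \<Omega> C))"
    and "H2_class (GalGroup \<Omega> K k) (units_group \<Omega> C)
           (c [^]\<^bsub>cocycles2 (GalGroup \<Omega> K k) (units_group \<Omega> C)\<^esub> s)
         = \<one>\<^bsub>H2 (GalGroup \<Omega> K k) (units_group \<Omega> C)\<^esub>"
    and "f \<in> Gal \<Omega> K k \<rightarrow> K - {\<zero>\<^bsub>\<Omega>\<^esub>}"
    and "\<forall>\<sigma> \<in> Gal \<Omega> K k. \<forall>\<tau> \<in> Gal \<Omega> K k.
           f (\<sigma> \<otimes>\<^bsub>GalGroup \<Omega> K k\<^esub> \<tau>) = c (\<sigma>, \<tau>) \<otimes>\<^bsub>\<Omega>\<^esub> f \<sigma> \<otimes>\<^bsub>\<Omega>\<^esub> \<sigma> (f \<tau>)"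
  shows
    "(\<forall>w \<in> carrier \<Omega>.
        w [^]\<^bsub>\<Omega>\<^esub> m = (\<Otimes>\<^bsub>\<Omega>\<^esub>\<tau> \<in> Gal \<Omega> K k. f \<tau>) \<longrightarrow>
        descent_field \<Omega> C k K c (generate_field \<Omega> (insert w K)))
     \<and>
     (let is_splitting = (\<lambda>d. d \<in> Gal \<Omega> K k \<rightarrow> C - {\<zero>\<^bsub>\<Omega>\<^esub>} \<and>
            (\<forall>\<sigma> \<in> Gal \<Omega> K k. \<forall>\<tau> \<in> Gal \<Omega> K k.
               d (\<sigma> \<otimes>\<^bsub>GalGroup \<Omega> K k\<^esub> \<tau>) = c (\<sigma>, \<tau>) [^]\<^bsub>\<Omega>\<^esub> s \<otimes>\<^bsub>\<Omega>\<^esub> d \<sigma> \<otimes>\<^bsub>\<Omega>\<^esub> d \<tau>));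
          is_F = (\<lambda>d F. F \<in> K - {\<zero>\<^bsub>\<Omega>\<^esub>} \<and>
            (\<forall>\<sigma> \<in> Gal \<Omega> K k. f \<sigma> [^]\<^bsub>\<Omega>\<^esub> s \<otimes>\<^bsub>\<Omega>\<^esub> inv\<^bsub>\<Omega>\<^esub> d \<sigma> = \<sigma> F \<otimes>\<^bsub>\<Omega>\<^esub> inv\<^bsub>\<Omega>\<^esub> F))
      in (\<exists>d. is_splitting d) \<and>
         (\<forall>d. is_splitting d \<longrightarrow>
            (\<exists>F. is_F d F) \<and>
            (\<forall>F. is_F d F \<longrightarrow>
               (\<forall>w \<in> carrier \<Omega>. w [^]\<^bsub>\<Omega>\<^esub> s = F \<longrightarrow>
                  descent_field \<Omega> C k K c (generate_field \<Omega> (insert w K))))))"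
proof -
  interpret field \<Omega> by fact
  let ?\<Gamma> = "Gal \<Omega> K k" and ?U = "units_group \<Omega> C"
  note C = assms(2)
  have sub: "subfield K \<Omega>" "subfield k \<Omega>" "k \<subseteq> K"
    using assms(6) unfolding finite_galois_def by blast+
  interpret galois_extension \<Omega> K k
    by (intro galois_extension.intro subfield_pair.intro subfield_pair_axioms.intro
        galois_extension_axioms.intro field_axioms sub assms(6))
  have Ck: "C \<subseteq> k"
  proof -
    have "insert z C \<subseteq> k"
      using assms(5) generate_field.incl[of _ "insert z C" \<Omega>]
      unfolding finite_ext_of_rational_functions_def by blast
    then show ?thesis by simp
  qed
  have Cc: "x \<in> carrier \<Omega>" if "x \<in> C" for x using that Ck k_carrier by blast
  have c_PiE: "c \<in> ?\<Gamma> \<times> ?\<Gamma> \<rightarrow>\<^sub>E C - {\<zero>\<^bsub>\<Omega>\<^esub>}"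
    using assms(9) by (simp add: cocycles2_def Let_def)
  have c: "c (\<sigma>, \<tau>) \<in> C - {\<zero>\<^bsub>\<Omega>\<^esub>}" if "\<sigma> \<in> ?\<Gamma>" "\<tau> \<in> ?\<Gamma>" for \<sigma> \<tau>
    using PiE_mem[OF c_PiE, of "(\<sigma>, \<tau>)"] that by simp
  have f: "f \<sigma> \<in> K - {\<zero>\<^bsub>\<Omega>\<^esub>}" if "\<sigma> \<in> ?\<Gamma>" for \<sigma> using assms(11) that by auto
  have cf: "f (\<sigma> \<otimes>\<^bsub>GalGroup \<Omega> K k\<^esub> \<tau>) = c (\<sigma>, \<tau>) \<otimes>\<^bsub>\<Omega>\<^esub> f \<sigma> \<otimes>\<^bsub>\<Omega>\<^esub> \<sigma> (f \<tau>)"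
    if "\<sigma> \<in> ?\<Gamma>" "\<tau> \<in> ?\<Gamma>" for \<sigma> \<tau>
    using assms(12) that by blast
  have fU: "f \<sigma> \<in> Units \<Omega>" "f \<sigma> \<in> carrier \<Omega>" if "\<sigma> \<in> ?\<Gamma>" for \<sigma>
    using f[OF that] K_carrier field_Units by auto
  have descent: "descent_field \<Omega> C k K c (generate_field \<Omega> (insert w K))"
    if "0 < n" "\<And>\<sigma>. \<sigma> \<in> ?\<Gamma> \<Longrightarrow> d \<sigma> \<in> C - {\<zero>\<^bsub>\<Omega>\<^esub>}" "F \<in> K - {\<zero>\<^bsub>\<Omega>\<^esub>}"
      "\<And>\<sigma>. \<sigma> \<in> ?\<Gamma> \<Longrightarrow> f \<sigma> [^]\<^bsub>\<Omega>\<^esub> n \<otimes>\<^bsub>\<Omega>\<^esub> inv\<^bsub>\<Omega>\<^esub> d \<sigma> = \<sigma> F \<otimes>\<^bsub>\<Omega>\<^esub> inv\<^bsub>\<Omega>\<^esub> F"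
      "w \<in> carrier \<Omega>" "w [^]\<^bsub>\<Omega>\<^esub> n = F" for n :: nat and d F w
    by (rule descent_field_of_root[where c = c and f = f, OF C Ck assms(3,4)])
      (fact c f cf that)+

  have part1: "descent_field \<Omega> C k K c (generate_field \<Omega> (insert w K))"
    if w: "w \<in> carrier \<Omega>" "w [^]\<^bsub>\<Omega>\<^esub> m = (\<Otimes>\<^bsub>\<Omega>\<^esub>\<tau> \<in> ?\<Gamma>. f \<tau>)" for w
  proof -
    define G where "G = (\<Otimes>\<^bsub>\<Omega>\<^esub>\<tau> \<in> ?\<Gamma>. f \<tau>)"
    define e where "e \<sigma> = (\<Otimes>\<^bsub>\<Omega>\<^esub>\<tau> \<in> ?\<Gamma>. c (\<sigma>, \<tau>))" for \<sigma>
    have m: "m = card ?\<Gamma>" using card_gal[OF assms(7)] by simp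
    have m0: "0 < m" unfolding m using finite_gal id_in_gal card_gt_0_iff by blast
    have "f \<in> ?\<Gamma> \<rightarrow> K - {\<zero>\<^bsub>\<Omega>\<^esub>}" by (rule assms(11))
    hence GK: "G \<in> K - {\<zero>\<^bsub>\<Omega>\<^esub>}" unfolding G_def by (rule finprod_in_subfield_units[OF subfield_K])
    have GU: "G \<in> Units \<Omega>" "G \<in> carrier \<Omega>" using GK K_carrier field_Units by auto
    have eC: "e \<sigma> \<in> C - {\<zero>\<^bsub>\<Omega>\<^esub>}" if "\<sigma> \<in> ?\<Gamma>" for \<sigma>
      unfolding e_def using c[OF that] by (intro finprod_in_subfield_units[OF C]) auto
    have eU: "e \<sigma> \<in> Units \<Omega>" if "\<sigma> \<in> ?\<Gamma>" for \<sigma> using eC[OF that] Cc field_Units by auto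
    have w0: "w \<noteq> \<zero>\<^bsub>\<Omega>\<^esub>" using w(2) GK m0 unfolding G_def[symmetric] by (auto simp: nat_pow_zero)
    have wU: "w \<in> Units \<Omega>" using w(1) w0 field_Units by simp
    \<comment> \<open>The norm relation divided by \<open>\<sigma> G\<close> is the equation for \<open>F = inv G\<close> and \<open>d = inv e\<close>.\<close>
    have "descent_field \<Omega> C k K c (generate_field \<Omega> (insert (inv\<^bsub>\<Omega>\<^esub> w) K))"
    proof (rule descent[of m "\<lambda>\<sigma>. inv\<^bsub>\<Omega>\<^esub> e \<sigma>" "inv\<^bsub>\<Omega>\<^esub> G", OF m0])
      show "inv\<^bsub>\<Omega>\<^esub> e \<sigma> \<in> C - {\<zero>\<^bsub>\<Omega>\<^esub>}" if "\<sigma> \<in> ?\<Gamma>" for \<sigma>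
        by (rule subfield_m_inv(1)[OF C eC[OF that]])
      show "inv\<^bsub>\<Omega>\<^esub> G \<in> K - {\<zero>\<^bsub>\<Omega>\<^esub>}" by (rule subfield_m_inv(1)[OF subfield_K GK])
      show "inv\<^bsub>\<Omega>\<^esub> w \<in> carrier \<Omega>" using wU by (rule Units_inv_closed)
      have "inv\<^bsub>\<Omega>\<^esub> w [^]\<^bsub>\<Omega>\<^esub> m \<otimes>\<^bsub>\<Omega>\<^esub> G = \<one>\<^bsub>\<Omega>\<^esub>"
        using nat_pow_distrib[of "inv\<^bsub>\<Omega>\<^esub> w" w m] wU w unfolding G_def by simp
      then show "inv\<^bsub>\<Omega>\<^esub> w [^]\<^bsub>\<Omega>\<^esub> m = inv\<^bsub>\<Omega>\<^esub> G"
        using GU wU by (metis Units_inv_closed inv_char m_comm nat_pow_closed Units_inv_inv)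
    next
      fix \<sigma> assume s: "\<sigma> \<in> ?\<Gamma>"
      have y: "\<sigma> G \<in> Units \<Omega>" "\<sigma> G \<in> carrier \<Omega>"
        using GK gal_closed[OF s] gal_eq_zero[OF s] K_carrier field_Units by auto
      have u: "f \<sigma> [^]\<^bsub>\<Omega>\<^esub> m \<in> carrier \<Omega>" "e \<sigma> \<in> carrier \<Omega>" using fU[OF s] eU[OF s] by auto
      have norm: "G = e \<sigma> \<otimes>\<^bsub>\<Omega>\<^esub> f \<sigma> [^]\<^bsub>\<Omega>\<^esub> m \<otimes>\<^bsub>\<Omega>\<^esub> \<sigma> G"
        unfolding G_def e_def m by (rule norm_of_cochain[OF C]) (fact c[OF s] f cf[OF s] s)+
      have "inv\<^bsub>\<Omega>\<^esub> (\<sigma> G) \<otimes>\<^bsub>\<Omega>\<^esub> G = inv\<^bsub>\<Omega>\<^esub> (\<sigma> G) \<otimes>\<^bsub>\<Omega>\<^esub> (e \<sigma> \<otimes>\<^bsub>\<Omega>\<^esub> f \<sigma> [^]\<^bsub>\<Omega>\<^esub> m \<otimes>\<^bsub>\<Omega>\<^esub> \<sigma> G)"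
        by (rule arg_cong[OF norm])
      also have "\<dots> = f \<sigma> [^]\<^bsub>\<Omega>\<^esub> m \<otimes>\<^bsub>\<Omega>\<^esub> e \<sigma> \<otimes>\<^bsub>\<Omega>\<^esub> (inv\<^bsub>\<Omega>\<^esub> (\<sigma> G) \<otimes>\<^bsub>\<Omega>\<^esub> \<sigma> G)"
        using y u Units_inv_closed[OF y(1)] by (simp only: m_ac m_closed)
      also have "\<dots> = f \<sigma> [^]\<^bsub>\<Omega>\<^esub> m \<otimes>\<^bsub>\<Omega>\<^esub> e \<sigma>" using y u by simp
      finally show "f \<sigma> [^]\<^bsub>\<Omega>\<^esub> m \<otimes>\<^bsub>\<Omega>\<^esub> inv\<^bsub>\<Omega>\<^esub> (inv\<^bsub>\<Omega>\<^esub> e \<sigma>) = \<sigma> (inv\<^bsub>\<Omega>\<^esub> G) \<otimes>\<^bsub>\<Omega>\<^esub> inv\<^bsub>\<Omega>\<^esub> (inv\<^bsub>\<Omega>\<^esub> G)"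
        using gal_inv[OF s, of G] GK GU eU[OF s] by simp
    qed
    then show ?thesis using generate_field_insert_inv[OF K_closed(1) wU] by simp
  qed

  have cs: "c [^]\<^bsub>cocycles2 (GalGroup \<Omega> K k) ?U\<^esub> s
      = (\<lambda>i \<in> ?\<Gamma> \<times> ?\<Gamma>. c i [^]\<^bsub>\<Omega>\<^esub> s)"
    by (simp add: cocycles2_pow units_group_simps)
  have "(\<lambda>i \<in> ?\<Gamma> \<times> ?\<Gamma>. c i [^]\<^bsub>\<Omega>\<^esub> s) \<in> ?\<Gamma> \<times> ?\<Gamma> \<rightarrow>\<^sub>E C - {\<zero>\<^bsub>\<Omega>\<^esub>}"
  proof -
    interpret U: comm_group ?U by (rule comm_group_units_group[OF C])
    have "x [^]\<^bsub>\<Omega>\<^esub> s \<in> C - {\<zero>\<^bsub>\<Omega>\<^esub>}" if "x \<in> C - {\<zero>\<^bsub>\<Omega>\<^esub>}" for x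
      using U.nat_pow_closed[of x s] that by (simp add: units_group_simps)
    then show ?thesis using PiE_mem[OF c_PiE] by (intro PiE_I) auto
  qed
  hence "c [^]\<^bsub>cocycles2 (GalGroup \<Omega> K k) ?U\<^esub> s \<in> coboundaries2 (GalGroup \<Omega> K k) ?U"
    using assms(10) H2_class_eq_one_iff[OF comm_group_units_group[OF C] group_GalGroup]
    unfolding cs by (simp add: units_group_simps)
  then obtain b where b: "b \<in> ?\<Gamma> \<rightarrow> C - {\<zero>\<^bsub>\<Omega>\<^esub>}"
    and cb: "(\<lambda>i \<in> ?\<Gamma> \<times> ?\<Gamma>. c i [^]\<^bsub>\<Omega>\<^esub> s) = (\<lambda>(\<sigma>, \<tau>) \<in> ?\<Gamma> \<times> ?\<Gamma>.
        b \<sigma> \<otimes>\<^bsub>\<Omega>\<^esub> b \<tau> \<otimes>\<^bsub>\<Omega>\<^esub> inv\<^bsub>?U\<^esub> b (\<sigma> \<otimes>\<^bsub>GalGroup \<Omega> K k\<^esub> \<tau>))"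
    unfolding cs coboundary_mem_iff by (auto simp: units_group_simps)
  have bC: "b \<sigma> \<in> C - {\<zero>\<^bsub>\<Omega>\<^esub>}" if "\<sigma> \<in> ?\<Gamma>" for \<sigma> using b that by auto
  have bU: "b \<sigma> \<in> Units \<Omega>" if "\<sigma> \<in> ?\<Gamma>" for \<sigma> using bC[OF that] Cc field_Units by auto
  have csb: "c (\<sigma>, \<tau>) [^]\<^bsub>\<Omega>\<^esub> s = b \<sigma> \<otimes>\<^bsub>\<Omega>\<^esub> b \<tau> \<otimes>\<^bsub>\<Omega>\<^esub> inv\<^bsub>\<Omega>\<^esub> b (\<sigma> \<otimes>\<^bsub>GalGroup \<Omega> K k\<^esub> \<tau>)"
    if "\<sigma> \<in> ?\<Gamma>" "\<tau> \<in> ?\<Gamma>" for \<sigma> \<tau>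
    using fun_cong[OF cb, of "(\<sigma>, \<tau>)"] that units_group_inv[OF C bC[OF gal_comp_mem[OF that]]] by simp

  have part2a: "inv\<^bsub>\<Omega>\<^esub> b (\<sigma> \<otimes>\<^bsub>GalGroup \<Omega> K k\<^esub> \<tau>)
      = c (\<sigma>, \<tau>) [^]\<^bsub>\<Omega>\<^esub> s \<otimes>\<^bsub>\<Omega>\<^esub> inv\<^bsub>\<Omega>\<^esub> b \<sigma> \<otimes>\<^bsub>\<Omega>\<^esub> inv\<^bsub>\<Omega>\<^esub> b \<tau>"
    if st: "\<sigma> \<in> ?\<Gamma>" "\<tau> \<in> ?\<Gamma>" for \<sigma> \<tau>
  proof -
    have "x \<otimes>\<^bsub>\<Omega>\<^esub> y \<otimes>\<^bsub>\<Omega>\<^esub> v \<otimes>\<^bsub>\<Omega>\<^esub> inv\<^bsub>\<Omega>\<^esub> x \<otimes>\<^bsub>\<Omega>\<^esub> inv\<^bsub>\<Omega>\<^esub> y = v"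
      if "x \<in> Units \<Omega>" "y \<in> Units \<Omega>" "v \<in> carrier \<Omega>" for x y v
    proof -
      have "x \<otimes>\<^bsub>\<Omega>\<^esub> y \<otimes>\<^bsub>\<Omega>\<^esub> v \<otimes>\<^bsub>\<Omega>\<^esub> inv\<^bsub>\<Omega>\<^esub> x \<otimes>\<^bsub>\<Omega>\<^esub> inv\<^bsub>\<Omega>\<^esub> y
          = (x \<otimes>\<^bsub>\<Omega>\<^esub> inv\<^bsub>\<Omega>\<^esub> x) \<otimes>\<^bsub>\<Omega>\<^esub> ((y \<otimes>\<^bsub>\<Omega>\<^esub> inv\<^bsub>\<Omega>\<^esub> y) \<otimes>\<^bsub>\<Omega>\<^esub> v)"
        using Units_closed[OF that(1)] Units_closed[OF that(2)] that(3)
          Units_inv_closed[OF that(1)] Units_inv_closed[OF that(2)] by (simp only: m_ac m_closed)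
      then show ?thesis using that by simp
    qed
    from this[OF bU[OF st(1)] bU[OF st(2)] Units_inv_closed[OF bU[OF gal_comp_mem[OF st]]]]
    show ?thesis unfolding csb[OF st] by simp
  qed
  have splitting: "(\<lambda>\<sigma>. inv\<^bsub>\<Omega>\<^esub> b \<sigma>) \<in> ?\<Gamma> \<rightarrow> C - {\<zero>\<^bsub>\<Omega>\<^esub>}"
    using subfield_m_inv(1)[OF C bC] by blast

  have part2b: "\<exists>F. F \<in> K - {\<zero>\<^bsub>\<Omega>\<^esub>} \<and>
      (\<forall>\<sigma> \<in> ?\<Gamma>. f \<sigma> [^]\<^bsub>\<Omega>\<^esub> s \<otimes>\<^bsub>\<Omega>\<^esub> inv\<^bsub>\<Omega>\<^esub> d \<sigma> = \<sigma> F \<otimes>\<^bsub>\<Omega>\<^esub> inv\<^bsub>\<Omega>\<^esub> F)"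
    if dC: "d \<in> ?\<Gamma> \<rightarrow> C - {\<zero>\<^bsub>\<Omega>\<^esub>}"
      and dc: "\<forall>\<sigma> \<in> ?\<Gamma>. \<forall>\<tau> \<in> ?\<Gamma>. d (\<sigma> \<otimes>\<^bsub>GalGroup \<Omega> K k\<^esub> \<tau>)
        = c (\<sigma>, \<tau>) [^]\<^bsub>\<Omega>\<^esub> s \<otimes>\<^bsub>\<Omega>\<^esub> d \<sigma> \<otimes>\<^bsub>\<Omega>\<^esub> d \<tau>" for d
  proof -
    have d: "d \<sigma> \<in> C - {\<zero>\<^bsub>\<Omega>\<^esub>}" if "\<sigma> \<in> ?\<Gamma>" for \<sigma> using dC that by auto
    have dinv: "inv\<^bsub>\<Omega>\<^esub> d \<sigma> \<in> k" "inv\<^bsub>\<Omega>\<^esub> d \<sigma> \<in> K" "inv\<^bsub>\<Omega>\<^esub> d \<sigma> \<in> carrier \<Omega>" "inv\<^bsub>\<Omega>\<^esub> d \<sigma> \<noteq> \<zero>\<^bsub>\<Omega>\<^esub>"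
      if "\<sigma> \<in> ?\<Gamma>" for \<sigma>
      using subfield_m_inv(1)[OF C d[OF that]] Ck k_subset_K Cc by auto
    have dU: "d \<sigma> \<in> Units \<Omega>" if "\<sigma> \<in> ?\<Gamma>" for \<sigma> using d[OF that] Cc field_Units by auto
    let ?g = "\<lambda>\<sigma>. f \<sigma> [^]\<^bsub>\<Omega>\<^esub> s \<otimes>\<^bsub>\<Omega>\<^esub> inv\<^bsub>\<Omega>\<^esub> d \<sigma>"
    have fs: "f \<sigma> [^]\<^bsub>\<Omega>\<^esub> s \<in> K" "f \<sigma> [^]\<^bsub>\<Omega>\<^esub> s \<in> carrier \<Omega>" "f \<sigma> [^]\<^bsub>\<Omega>\<^esub> s \<in> Units \<Omega>" if "\<sigma> \<in> ?\<Gamma>" for \<sigma>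
      using f[OF that] fU[OF that] K_pow Units_pow_closed by auto
    have g: "?g \<in> ?\<Gamma> \<rightarrow> K - {\<zero>\<^bsub>\<Omega>\<^esub>}"
    proof
      fix \<sigma> assume s: "\<sigma> \<in> ?\<Gamma>"
      have "f \<sigma> [^]\<^bsub>\<Omega>\<^esub> s \<noteq> \<zero>\<^bsub>\<Omega>\<^esub>" using fs(3)[OF s] field_Units by auto
      then show "?g \<sigma> \<in> K - {\<zero>\<^bsub>\<Omega>\<^esub>}"
        using K_closed(6)[OF fs(1)[OF s] dinv(2)[OF s]] dinv(3,4)[OF s] fs(2)[OF s]
        by (simp add: integral_iff)
    qed
    have gg: "?g (\<sigma> \<otimes>\<^bsub>GalGroup \<Omega> K k\<^esub> \<tau>) = ?g \<sigma> \<otimes>\<^bsub>\<Omega>\<^esub> \<sigma> (?g \<tau>)"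
      if st: "\<sigma> \<in> ?\<Gamma>" "\<tau> \<in> ?\<Gamma>" for \<sigma> \<tau>
    proof -
      let ?c = "c (\<sigma>, \<tau>)" and ?t = "\<sigma> (f \<tau>)"
      have cU: "?c \<in> Units \<Omega>" "?c \<in> carrier \<Omega>" "?c [^]\<^bsub>\<Omega>\<^esub> s \<in> Units \<Omega>"
        using c[OF st] Cc field_Units by (auto intro!: Units_pow_closed)
      have t: "?t \<in> carrier \<Omega>" using gal_closed[OF st(1)] f[OF st(2)] K_carrier by auto
      have "f (\<sigma> \<otimes>\<^bsub>GalGroup \<Omega> K k\<^esub> \<tau>) [^]\<^bsub>\<Omega>\<^esub> s
          = ?c [^]\<^bsub>\<Omega>\<^esub> s \<otimes>\<^bsub>\<Omega>\<^esub> f \<sigma> [^]\<^bsub>\<Omega>\<^esub> s \<otimes>\<^bsub>\<Omega>\<^esub> ?t [^]\<^bsub>\<Omega>\<^esub> s"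
        unfolding cf[OF st] using cU(2) fU(2)[OF st(1)] t by (simp add: nat_pow_distrib)
      moreover have "inv\<^bsub>\<Omega>\<^esub> d (\<sigma> \<otimes>\<^bsub>GalGroup \<Omega> K k\<^esub> \<tau>)
          = inv\<^bsub>\<Omega>\<^esub> (?c [^]\<^bsub>\<Omega>\<^esub> s) \<otimes>\<^bsub>\<Omega>\<^esub> inv\<^bsub>\<Omega>\<^esub> d \<sigma> \<otimes>\<^bsub>\<Omega>\<^esub> inv\<^bsub>\<Omega>\<^esub> d \<tau>"
        using dc st cU(3) dU by (simp add: Units_inv_mult)
      moreover have "\<sigma> (?g \<tau>) = ?t [^]\<^bsub>\<Omega>\<^esub> s \<otimes>\<^bsub>\<Omega>\<^esub> inv\<^bsub>\<Omega>\<^esub> d \<tau>"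
        using gal_mult[OF st(1) fs(1)[OF st(2)] dinv(2)[OF st(2)]] gal_pow[OF st(1), of "f \<tau>" s]
          gal_fix[OF st(1) dinv(1)[OF st(2)]] f[OF st(2)] by simp
      moreover have "(x \<otimes>\<^bsub>\<Omega>\<^esub> p \<otimes>\<^bsub>\<Omega>\<^esub> q) \<otimes>\<^bsub>\<Omega>\<^esub> (inv\<^bsub>\<Omega>\<^esub> x \<otimes>\<^bsub>\<Omega>\<^esub> i \<otimes>\<^bsub>\<Omega>\<^esub> j) = (p \<otimes>\<^bsub>\<Omega>\<^esub> i) \<otimes>\<^bsub>\<Omega>\<^esub> (q \<otimes>\<^bsub>\<Omega>\<^esub> j)"
        if "x \<in> Units \<Omega>" "p \<in> carrier \<Omega>" "q \<in> carrier \<Omega>" "i \<in> carrier \<Omega>" "j \<in> carrier \<Omega>" for x p q i j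
      proof -
        have "(x \<otimes>\<^bsub>\<Omega>\<^esub> p \<otimes>\<^bsub>\<Omega>\<^esub> q) \<otimes>\<^bsub>\<Omega>\<^esub> (inv\<^bsub>\<Omega>\<^esub> x \<otimes>\<^bsub>\<Omega>\<^esub> i \<otimes>\<^bsub>\<Omega>\<^esub> j)
            = (x \<otimes>\<^bsub>\<Omega>\<^esub> inv\<^bsub>\<Omega>\<^esub> x) \<otimes>\<^bsub>\<Omega>\<^esub> ((p \<otimes>\<^bsub>\<Omega>\<^esub> i) \<otimes>\<^bsub>\<Omega>\<^esub> (q \<otimes>\<^bsub>\<Omega>\<^esub> j))"
          using that Units_closed[OF that(1)] Units_inv_closed[OF that(1)] by (simp only: m_ac m_closed)
        then show ?thesis using that by simp
      qed
      ultimately show ?thesis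
        using cU(3) fs(2)[OF st(1)] nat_pow_closed[OF t] dinv(3)[OF st(1)] dinv(3)[OF st(2)] by simp
    qed
    show ?thesis
    proof (rule hilbert90[OF g])
      show "?g (\<sigma> \<otimes>\<^bsub>GalGroup \<Omega> K k\<^esub> \<tau>) = ?g \<sigma> \<otimes>\<^bsub>\<Omega>\<^esub> \<sigma> (?g \<tau>)"
        if "\<sigma> \<in> ?\<Gamma>" "\<tau> \<in> ?\<Gamma>" for \<sigma> \<tau> by (rule gg[OF that])
    next
      fix F assume "F \<in> K - {\<zero>\<^bsub>\<Omega>\<^esub>}"
        and "\<And>\<sigma>. \<sigma> \<in> ?\<Gamma> \<Longrightarrow> ?g \<sigma> = \<sigma> F \<otimes>\<^bsub>\<Omega>\<^esub> inv\<^bsub>\<Omega>\<^esub> F"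
      then show ?thesis by (intro exI[of _ F] conjI ballI)
    qed
  qed

  have part2c: "descent_field \<Omega> C k K c (generate_field \<Omega> (insert w K))"
    if "d \<in> ?\<Gamma> \<rightarrow> C - {\<zero>\<^bsub>\<Omega>\<^esub>}" "F \<in> K - {\<zero>\<^bsub>\<Omega>\<^esub>}"
      "\<forall>\<sigma> \<in> ?\<Gamma>. f \<sigma> [^]\<^bsub>\<Omega>\<^esub> s \<otimes>\<^bsub>\<Omega>\<^esub> inv\<^bsub>\<Omega>\<^esub> d \<sigma> = \<sigma> F \<otimes>\<^bsub>\<Omega>\<^esub> inv\<^bsub>\<Omega>\<^esub> F"
      "w \<in> carrier \<Omega>" "w [^]\<^bsub>\<Omega>\<^esub> s = F" for d F w
    using that assms(8) by (intro descent[of s d F w]) auto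

  show ?thesis
    unfolding Let_def using part1 part2a splitting part2b part2c by blast
qed

end
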